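(* Let $\mathcal{H}$ be a finite-dimensional Hilbert space, let $\mathcal{E}$ be a quantum channel on $\mathcal{L}(\mathcal{H})$, and let $\mathcal{C}=\mathcal{A}\otimes\mathcal{B}\subseteq\mathcal{H}$ be a subspace. The following are equivalent: (1) the subsystem $\mathcal{B}$ is correctable for $\mathcal{E}$; (2) there is a $*$-homomorphism $\pi:\mathfrak{A}_{\mathcal{B}}\to\mathcal{L}(\mathcal{H})$ such that $$\mathcal{E}(\rho)=\pi(\rho)\,\mathcal{E}(P_{\mathcal{C}})=\mathcal{E}(P_{\mathcal{C}})\,\pi(\rho)\quad\text{for all }\rho\in\mathfrak{A}_{\mathcal{B}}.$$
   Context: A quantum channel is a completely positive trace-preserving linear map. $\mathcal{H}=(\mathcal{A}\otimes\mathcal{B})\oplus\mathcal{C}^\perp$; for operators $X$ on $\mathcal{A}$ and $Y$ on $\mathcal{B}$, $X\otimes Y$ denotes $(X\otimes Y)\oplus 0_{\mathcal{C}^\perp}$ on $\mathcal{H}$. $P_{\mathcal{C}}=I_{\mathcal{A}}\otimes I_{\mathcal{B}}$ is the projection onto $\mathcal{C}$ and $\mathcal{P}_{\mathcal{C}}(\rho)=P_{\mathcal{C}}\rho P_{\mathcal{C}}$. $\mathfrak{A}_{\mathcal{B}}:=\{I_{\mathcal{A}}\otimes\rho_{\mathcal{B}}:\rho_{\mathcal{B}}\in\mathcal{L}(\mathcal{B})\}$ (so $P_{\mathcal{C}}\in\mathfrak{A}_{\mathcal{B}}$). A $*$-homomorphism is a linear map preserving products and adjoints (not necessarily unital). The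 subsystem $\mathcal{B}$ is correctable for $\mathcal{E}$ if there are a quantum channel $\mathcal{R}$ on $\mathcal{L}(\mathcal{H})$ and a quantum channel $\mathcal{F}_{\mathcal{A}}$ on $\mathcal{L}(\mathcal{A})$ with $\mathcal{R}\circ\mathcal{E}\circ\mathcal{P}_{\mathcal{C}}=(\mathcal{F}_{\mathcal{A}}\otimes\mathrm{id}_{\mathcal{B}})\circ\mathcal{P}_{\mathcal{C}}$. *)

theory Defs
  imports "Jordan_Normal_Form.Matrix"
begin

text \<open>Finite-dimensional Hilbert spaces are modelled as C^n; operators as complex n x n
matrices (carrier_mat n n); superoperators as functions on complex matrices.\<close>

definition adj :: "complex mat \<Rightarrow> complex mat" where
  "adj A = mat (dim_col A) (dim_row A) (\<lambda>(i,j). cnj (A $$ (j,i)))"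

definition psd :: "nat \<Rightarrow> complex mat \<Rightarrow> bool" where
  "psd n A \<longleftrightarrow> A \<in> carrier_mat n n \<and> adj A = A \<and>
     (\<forall>v::nat \<Rightarrow> complex. 0 \<le> Re (\<Sum>i<n. \<Sum>j<n. cnj (v i) * A $$ (i,j) * v j))"

definition lin_map :: "nat \<Rightarrow> nat \<Rightarrow> (complex mat \<Rightarrow> complex mat) \<Rightarrow> bool" where
  "lin_map n m E \<longleftrightarrow>
     (\<forall>A \<in> carrier_mat n n. E A \<in> carrier_mat m m) \<and>
     (\<forall>A \<in> carrier_mat n n. \<forall>B \<in> carrier_mat n n. E (A + B) = E A + E B) \<and>
     (\<forall>A \<in> carrier_mat n n. \<forall>c. E (c \<cdot>\<^sub>m A) = c \<cdot>\<^sub>m E A)"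

text \<open>(id_k \<otimes> E) applied to a (k n) x (k n) matrix viewed as a k x k block matrix
with n x n blocks.\<close>
definition ampliate :: "nat \<Rightarrow> nat \<Rightarrow> (complex mat \<Rightarrow> complex mat) \<Rightarrow> complex mat \<Rightarrow> complex mat" where
  "ampliate k n E M = mat (k*n) (k*n) (\<lambda>(r,s).
      E (mat n n (\<lambda>(p,q). M $$ ((r div n) * n + p, (s div n) * n + q))) $$ (r mod n, s mod n))"

definition completely_positive :: "nat \<Rightarrow> (complex mat \<Rightarrow> complex mat) \<Rightarrow> bool" where
  "completely_positive n E \<longleftrightarrow> (\<forall>k M. psd (k*n) M \<longrightarrow> psd (k*n) (ampliate k n E M))"

definition mtrace :: "complex mat \<Rightarrow> complex" where
  "mtrace A = (\<Sum>i<dim_row A. A $$ (i,i))"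

definition trace_preserving :: "nat \<Rightarrow> (complex mat \<Rightarrow> complex mat) \<Rightarrow> bool" where
  "trace_preserving n E \<longleftrightarrow> (\<forall>A \<in> carrier_mat n n. mtrace (E A) = mtrace A)"

definition quantum_channel :: "nat \<Rightarrow> (complex mat \<Rightarrow> complex mat) \<Rightarrow> bool" where
  "quantum_channel n E \<longleftrightarrow> lin_map n n E \<and> completely_positive n E \<and> trace_preserving n E"

text \<open>Kronecker product on C^dA \<otimes> C^dB, index (a,b) \<mapsto> a*dB + b.\<close>
definition kron :: "nat \<Rightarrow> nat \<Rightarrow> complex mat \<Rightarrow> complex mat \<Rightarrow> complex mat" where
  "kron dA dB X Y = mat (dA*dB) (dA*dB) (\<lambda>(r,s). X $$ (r div dB, s div dB) * Y $$ (r mod dB, s mod dB))"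

definition tensor_id :: "nat \<Rightarrow> nat \<Rightarrow> (complex mat \<Rightarrow> complex mat) \<Rightarrow> complex mat \<Rightarrow> complex mat" where
  "tensor_id dA dB F M = mat (dA*dB) (dA*dB) (\<lambda>(r,s).
      F (mat dA dA (\<lambda>(a,a'). M $$ (a*dB + r mod dB, a'*dB + s mod dB))) $$ (r div dB, s div dB))"

text \<open>The subspace C = A \<otimes> B of H = C^n is given by an isometry V : C^dA \<otimes> C^dB \<rightarrow> C^n
(its range is C); X \<otimes> Y on H means V (X \<otimes> Y) V^*, and P_C = V V^*.\<close>
definition isometry :: "nat \<Rightarrow> nat \<Rightarrow> complex mat \<Rightarrow> bool" where
  "isometry n d V \<longleftrightarrow> V \<in> carrier_mat n d \<and> adj V * V = 1\<^sub>m d"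

definition proj_C :: "complex mat \<Rightarrow> complex mat" where
  "proj_C V = V * adj V"

definition alg_B :: "nat \<Rightarrow> nat \<Rightarrow> complex mat \<Rightarrow> complex mat set" where
  "alg_B dA dB V = {V * kron dA dB (1\<^sub>m dA) Y * adj V | Y. Y \<in> carrier_mat dB dB}"

text \<open>*-homomorphism from a set S (a *-subalgebra) into L(C^n), not necessarily unital.\<close>
definition star_hom :: "complex mat set \<Rightarrow> nat \<Rightarrow> (complex mat \<Rightarrow> complex mat) \<Rightarrow> bool" where
  "star_hom S n \<pi> \<longleftrightarrow>
     (\<forall>x \<in> S. \<pi> x \<in> carrier_mat n n) \<and>
     (\<forall>x \<in> S. \<forall>y \<in> S. \<pi> (x + y) = \<pi> x + \<pi> y) \<and>
     (\<forall>x \<in> S. \<forall>c. \<pi> (c \<cdot>\<^sub>m x) = c \<cdot>\<^sub>m \<pi> x) \<and>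
     (\<forall>x \<in> S. \<forall>y \<in> S. \<pi> (x * y) = \<pi> x * \<pi> y) \<and>
     (\<forall>x \<in> S. \<pi> (adj x) = adj (\<pi> x))"

definition correctable_subsystem ::
  "nat \<Rightarrow> nat \<Rightarrow> nat \<Rightarrow> complex mat \<Rightarrow> (complex mat \<Rightarrow> complex mat) \<Rightarrow> bool" where
  "correctable_subsystem n dA dB V E \<longleftrightarrow>
     (\<exists>R F. quantum_channel n R \<and> quantum_channel dA F \<and>
        (\<forall>\<rho> \<in> carrier_mat n n.
           R (E (proj_C V * \<rho> * proj_C V)) = V * tensor_id dA dB F (adj V * \<rho> * V) * adj V))"

end

theory Submission
  imports Defs
begin

text \<open>
Write \<open>E\<^sub>k\<close> for Kraus operators of the channel (they exist by factoring the Choi matrix as a sum of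
rank-one positive matrices) and \<open>M\<^bsub>k,a\<^esub> = E\<^sub>k V (|a\<rangle> \<otimes> I)\<close> for their restrictions to the slices of the code.
Both conditions amount to an intertwining relation \<open>\<pi>(Y) E\<^sub>k V = E\<^sub>k V (I \<otimes> Y)\<close>.

If \<open>R\<close> with Kraus operators \<open>R\<^sub>j\<close> recovers the subsystem, positivity forces each \<open>R\<^sub>j M\<^bsub>k,a\<^esub>\<close> to have the form
\<open>V (t \<otimes> I)\<close>, and \<open>\<Sum>\<^sub>j R\<^sub>j\<^sup>* R\<^sub>j = I\<close> then makes every \<open>M\<^bsub>l,b\<^esub>\<^sup>* M\<^bsub>k,a\<^esub>\<close> scalar. Gram-Schmidt, carried
out with scalar coefficients, produces isometries \<open>W\<^sub>m\<close> with orthogonal ranges which span the \<open>M\<^bsub>k,a\<^esub>\<close>, and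
\<open>\<pi>(Y) = \<Sum>\<^sub>m W\<^sub>m Y W\<^sub>m\<^sup>*\<close>.

Conversely, given \<open>\<pi>\<close>, expanding \<open>\<Sum>\<^sub>k |E\<^sub>k V (I \<otimes> Y) - \<pi>(Y) E\<^sub>k V|\<^sup>2\<close> shows that it vanishes. The adjoint of
\<open>\<pi>\<close>, whose value at \<open>\<rho>\<close> has entries \<open>tr (\<rho> \<pi>(e\<^bsub>b'b\<^esub>))\<close>, therefore maps \<open>E (V X V\<^sup>*)\<close> to \<open>tr\<^sub>A X\<close>; composed
with a fixed state on \<open>A\<close>, and completed on the complement of \<open>\<pi>(P)\<close>, it is a recovery channel with
\<open>F X = tr X |0\<rangle>\<langle>0|\<close>.
\<close>

section \<open>Finitely supported matrices\<close>

text \<open>Embedding all rectangular matrices into one non-unital ring removes the dimension side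
conditions from associativity and distributivity; \<open>dims n m\<close> records the shape only where it matters.\<close>

typedef fmat = "{f :: nat \<Rightarrow> nat \<Rightarrow> complex. \<exists>N. \<forall>i j. N \<le> i \<or> N \<le> j \<longrightarrow> f i j = 0}"
  morphisms ent Abs_fmat
  by (rule exI[of _ "\<lambda>_ _. 0"]) auto

setup_lifting type_definition_fmat

lemma fmat_eqI: "(\<And>i j. ent A i j = ent B i j) \<Longrightarrow> A = B"
  by (metis ent_inject ext)

definition dims :: "nat \<Rightarrow> nat \<Rightarrow> fmat \<Rightarrow> bool" where
  "dims n m A \<longleftrightarrow> (\<forall>i j. n \<le> i \<or> m \<le> j \<longrightarrow> ent A i j = 0)"

lemma dimsD: "dims n m A \<Longrightarrow> n \<le> i \<or> m \<le> j \<Longrightarrow> ent A i j = 0"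
  by (auto simp: dims_def)

lemma fmat_dims_eqI:
  assumes "dims n m A" "dims n m B" "\<And>i j. i < n \<Longrightarrow> j < m \<Longrightarrow> ent A i j = ent B i j"
  shows "A = B"
proof (rule fmat_eqI)
  fix i j
  show "ent A i j = ent B i j"
    by (cases "i < n \<and> j < m") (use assms dimsD[of n m _ i j] in auto)
qed

lemma dims_mono: "dims n m A \<Longrightarrow> n \<le> n' \<Longrightarrow> m \<le> m' \<Longrightarrow> dims n' m' A"
  by (auto simp: dims_def)

lemma dims_exists: "\<exists>N. dims N N A"
  using ent[of A] by (auto simp: dims_def)

lemma dims_exists2: "\<exists>N. dims N N A \<and> dims N N B"
proof -
  obtain M N where "dims M M A" "dims N N B" using dims_exists by metis
  then have "dims (max M N) (max M N) A \<and> dims (max M N) (max M N) B"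
    by (meson dims_mono max.cobounded1 max.cobounded2)
  then show ?thesis ..
qed

instantiation fmat :: "{zero,plus,minus,uminus,times}"
begin

lift_definition zero_fmat :: fmat is "\<lambda>_ _. 0" by auto

lift_definition plus_fmat :: "fmat \<Rightarrow> fmat \<Rightarrow> fmat" is "\<lambda>f g i j. f i j + g i j"
proof -
  fix f g :: "nat \<Rightarrow> nat \<Rightarrow> complex"
  assume "\<exists>N. \<forall>i j. N \<le> i \<or> N \<le> j \<longrightarrow> f i j = 0" "\<exists>N. \<forall>i j. N \<le> i \<or> N \<le> j \<longrightarrow> g i j = 0"
  then obtain M N where "\<forall>i j. M \<le> i \<or> M \<le> j \<longrightarrow> f i j = 0" "\<forall>i j. N \<le> i \<or> N \<le> j \<longrightarrow> g i j = 0"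
    by blast
  then show "\<exists>N. \<forall>i j. N \<le> i \<or> N \<le> j \<longrightarrow> f i j + g i j = 0"
    by (intro exI[of _ "max M N"]) auto
qed

lift_definition uminus_fmat :: "fmat \<Rightarrow> fmat" is "\<lambda>f i j. - f i j" by auto

definition minus_fmat :: "fmat \<Rightarrow> fmat \<Rightarrow> fmat" where "minus_fmat A B = A + - B"

text \<open>The summation runs over the support of row \<open>i\<close> of the left factor, a finite
  set, so the definition needs no common bound; \<open>ent_times\<close> and
  \<open>ent_times'\<close> replace it by a range that covers the columns of \<open>A\<close> or the
  rows of \<open>B\<close>.\<close>

lift_definition times_fmat :: "fmat \<Rightarrow> fmat \<Rightarrow> fmat"
  is "\<lambda>f g i j. \<Sum>k | f i k \<noteq> 0. f i k * g k j"
proof -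
  fix f g :: "nat \<Rightarrow> nat \<Rightarrow> complex"
  assume "\<exists>N. \<forall>i j. N \<le> i \<or> N \<le> j \<longrightarrow> f i j = 0" "\<exists>N. \<forall>i j. N \<le> i \<or> N \<le> j \<longrightarrow> g i j = 0"
  then obtain M N where "\<forall>i j. M \<le> i \<or> M \<le> j \<longrightarrow> f i j = 0" "\<forall>i j. N \<le> i \<or> N \<le> j \<longrightarrow> g i j = 0"
    by blast
  then show "\<exists>N. \<forall>i j. N \<le> i \<or> N \<le> j \<longrightarrow> (\<Sum>k | f i k \<noteq> 0. f i k * g k j) = 0"
    by (intro exI[of _ "max M N"]) auto
qed

instance ..
end

lift_definition fsmul :: "complex \<Rightarrow> fmat \<Rightarrow> fmat" (infixr "*\<^sub>C" 75) is "\<lambda>c f i j. c * f i j" by auto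

lift_definition fadj :: "fmat \<Rightarrow> fmat" ("_\<^sup>\<dagger>" [999] 999) is "\<lambda>f i j. cnj (f j i)" by auto

lift_definition funit :: "nat \<Rightarrow> nat \<Rightarrow> fmat" is "\<lambda>k l i j. if i = k \<and> j = l then 1 else 0"
  subgoal for k l by (rule exI[of _ "Suc (max k l)"]) auto
  done

lift_definition fid :: "nat \<Rightarrow> fmat" is "\<lambda>n i j. if i = j \<and> i < n then 1 else 0"
  subgoal for n by (rule exI[of _ n]) auto
  done

lemma ent_zero [simp]: "ent 0 i j = 0" by (transfer; simp)
lemma ent_plus [simp]: "ent (A + B) i j = ent A i j + ent B i j" by (transfer; simp)
lemma ent_uminus [simp]: "ent (- A) i j = - ent A i j" by (transfer; simp)
lemma ent_minus [simp]: "ent (A - B) i j = ent A i j - ent B i j" by (simp add: minus_fmat_def)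
lemma ent_fsmul [simp]: "ent (c *\<^sub>C A) i j = c * ent A i j" by (transfer; simp)
lemma ent_fadj [simp]: "ent (A\<^sup>\<dagger>) i j = cnj (ent A j i)" by (transfer; simp)
lemma ent_funit [simp]: "ent (funit k l) i j = (if i = k \<and> j = l then 1 else 0)" by (transfer; simp)
lemma ent_fid [simp]: "ent (fid n) i j = (if i = j \<and> i < n then 1 else 0)" by (transfer; simp)

lemma ent_times:
  assumes "dims n m A"
  shows "ent (A * B) i j = (\<Sum>k<m. ent A i k * ent B k j)"
proof -
  have "ent (A * B) i j = (\<Sum>k | ent A i k \<noteq> 0. ent A i k * ent B k j)"
    by (transfer; simp)
  also have "\<dots> = (\<Sum>k<m. ent A i k * ent B k j)"
    by (rule sum.mono_neutral_left) (use dimsD[OF assms] in \<open>auto simp: not_less[symmetric]\<close>)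
  finally show ?thesis .
qed

lemma ent_times':
  assumes "dims m n B"
  shows "ent (A * B) i j = (\<Sum>k<m. ent A i k * ent B k j)"
proof -
  obtain N where N: "dims N N A" using dims_exists by blast
  have "ent (A * B) i j = (\<Sum>k<N. ent A i k * ent B k j)" by (rule ent_times[OF N])
  \<comment> \<open>\<open>N\<close> may lie below \<open>m\<close>, so the range is first widened
    to cover both and then cut to \<open>m\<close>.\<close>
  also have "\<dots> = (\<Sum>k<max N m. ent A i k * ent B k j)"
    by (rule sum.mono_neutral_left) (use dimsD[OF N] in auto)
  also have "\<dots> = (\<Sum>k<m. ent A i k * ent B k j)"
    by (rule sum.mono_neutral_right) (use dimsD[OF assms] in auto)
  finally show ?thesis .
qed

instance fmat :: ring
proof
  fix A B C :: fmat
  show "A + B + C = A + (B + C)" "A + B = B + A" "0 + A = A" "- A + A = 0" "A - B = A + - B"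
    by (rule fmat_eqI; simp)+
  obtain N where N: "dims N N A" "dims N N B" using dims_exists2 by blast
  obtain M where M: "dims M M C" using dims_exists by blast
  show "(A + B) * C = A * C + B * C"
    by (rule fmat_eqI) (simp add: ent_times'[OF M] algebra_simps sum.distrib)
  show "A * (B + C) = A * B + A * C"
    by (rule fmat_eqI) (simp add: ent_times[OF N(1)] algebra_simps sum.distrib)
  show "A * B * C = A * (B * C)"
  proof (rule fmat_eqI)
    fix i j
    have "ent (A * B * C) i j = (\<Sum>l<M. (\<Sum>k<N. ent A i k * ent B k l) * ent C l j)"
      by (simp add: ent_times'[OF M] ent_times[OF N(1)])
    also have "\<dots> = (\<Sum>k<N. ent A i k * (\<Sum>l<M. ent B k l * ent C l j))"
      unfolding sum_distrib_left sum_distrib_right by (subst sum.swap) (simp add: algebra_simps)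
    also have "\<dots> = ent (A * (B * C)) i j"
      by (simp add: ent_times'[OF M] ent_times[OF N(1)])
    finally show "ent (A * B * C) i j = ent (A * (B * C)) i j" .
  qed
qed

lemma ent_sum [simp]: "ent (sum f I) i j = (\<Sum>x\<in>I. ent (f x) i j)"
  by (induction I rule: infinite_finite_induct) auto

lemma dims_zero [simp]: "dims n m 0" by (simp add: dims_def)
lemma dims_plus: "dims n m A \<Longrightarrow> dims n m B \<Longrightarrow> dims n m (A + B)" by (simp add: dims_def)
lemma dims_minus: "dims n m A \<Longrightarrow> dims n m B \<Longrightarrow> dims n m (A - B)" by (simp add: dims_def)
lemma dims_fsmul: "dims n m A \<Longrightarrow> dims n m (c *\<^sub>C A)" by (simp add: dims_def)
lemma dims_sum: "(\<And>x. x \<in> I \<Longrightarrow> dims n m (f x)) \<Longrightarrow> dims n m (sum f I)" by (simp add: dims_def)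
lemma dims_fadj: "dims n m A \<Longrightarrow> dims m n (A\<^sup>\<dagger>)" by (auto simp: dims_def)
lemma dims_funit: "k < n \<Longrightarrow> l < m \<Longrightarrow> dims n m (funit k l)" by (auto simp: dims_def)
lemma dims_fid [simp]: "dims n n (fid n)" by (auto simp: dims_def)
lemma dims_times: "dims n m A \<Longrightarrow> dims m k B \<Longrightarrow> dims n k (A * B)"
  unfolding dims_def[of n k] by (auto simp: ent_times dims_def)

lemmas dims_intros = dims_plus dims_minus dims_fsmul dims_sum dims_fadj dims_funit dims_times

lemma fid_times: "dims n m A \<Longrightarrow> fid n * A = A"
proof (rule fmat_eqI)
  fix i j assume A: "dims n m A"
  show "ent (fid n * A) i j = ent A i j"
    by (cases "i < n") (use dimsD[OF A] in \<open>auto simp: ent_times[OF dims_fid] if_distrib[of "\<lambda>x. x * _"] cong: if_cong\<close>)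
qed

lemma times_fid: "dims n m A \<Longrightarrow> A * fid m = A"
  by (rule fmat_eqI) (auto simp: ent_times'[OF dims_fid] dims_def if_distrib[of "\<lambda>x. _ * x"] cong: if_cong)

lemma fsmul_times [simp]: "(c *\<^sub>C A) * B = c *\<^sub>C (A * B)"
proof (rule fmat_eqI)
  fix i j
  obtain N where N: "dims N N A" using dims_exists by blast
  show "ent ((c *\<^sub>C A) * B) i j = ent (c *\<^sub>C (A * B)) i j"
    by (simp add: ent_times[OF dims_fsmul[OF N]] ent_times[OF N] sum_distrib_left mult.assoc)
qed

lemma times_fsmul [simp]: "A * (c *\<^sub>C B) = c *\<^sub>C (A * B)"
proof (rule fmat_eqI)
  fix i j
  obtain N where N: "dims N N A" using dims_exists by blast
  show "ent (A * (c *\<^sub>C B)) i j = ent (c *\<^sub>C (A * B)) i j"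
    by (simp add: ent_times[OF N] sum_distrib_left algebra_simps)
qed

lemma fsmul_fsmul [simp]: "c *\<^sub>C d *\<^sub>C A = (c * d) *\<^sub>C A" by (rule fmat_eqI) simp
lemma fsmul_one [simp]: "1 *\<^sub>C A = A" by (rule fmat_eqI) simp
lemma fsmul_zero [simp]: "0 *\<^sub>C A = 0" "c *\<^sub>C 0 = 0" by (rule fmat_eqI; simp)+
lemma fsmul_diff_left: "(c - d) *\<^sub>C A = c *\<^sub>C A - d *\<^sub>C A" by (rule fmat_eqI) (simp add: algebra_simps)
lemma fsmul_sum_left: "sum f I *\<^sub>C A = (\<Sum>x\<in>I. f x *\<^sub>C A)" by (rule fmat_eqI) (simp add: sum_distrib_right)
lemma fsmul_sum_right: "c *\<^sub>C sum f I = (\<Sum>x\<in>I. c *\<^sub>C f x)" by (rule fmat_eqI) (simp add: sum_distrib_left)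

lemma fadj_fadj [simp]: "A\<^sup>\<dagger>\<^sup>\<dagger> = A" by (rule fmat_eqI) simp
lemma fadj_zero [simp]: "0\<^sup>\<dagger> = 0" by (rule fmat_eqI) simp
lemma fadj_minus [simp]: "(A - B)\<^sup>\<dagger> = A\<^sup>\<dagger> - B\<^sup>\<dagger>" by (rule fmat_eqI) simp
lemma fadj_fsmul [simp]: "(c *\<^sub>C A)\<^sup>\<dagger> = cnj c *\<^sub>C A\<^sup>\<dagger>" by (rule fmat_eqI) simp
lemma fadj_sum [simp]: "(sum f I)\<^sup>\<dagger> = (\<Sum>x\<in>I. (f x)\<^sup>\<dagger>)" by (rule fmat_eqI) simp
lemma fadj_funit [simp]: "(funit k l)\<^sup>\<dagger> = funit l k" by (rule fmat_eqI) auto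
lemma fadj_fid [simp]: "(fid n)\<^sup>\<dagger> = fid n" by (rule fmat_eqI) auto

lemma fadj_times [simp]: "(A * B)\<^sup>\<dagger> = B\<^sup>\<dagger> * A\<^sup>\<dagger>"
proof (rule fmat_eqI)
  fix i j
  obtain N where N: "dims N N A" using dims_exists by blast
  show "ent ((A * B)\<^sup>\<dagger>) i j = ent (B\<^sup>\<dagger> * A\<^sup>\<dagger>) i j"
    by (simp add: ent_times[OF N] ent_times'[OF dims_fadj[OF N]] mult.commute)
qed

lemma ent_funit_times: "ent (funit k l * A) i j = (if i = k then ent A l j else 0)"
proof -
  have "dims (Suc k) (Suc l) (funit k l)" by (rule dims_funit) auto
  then show ?thesis by (simp add: ent_times if_distrib[of "\<lambda>x. x * _"] cong: if_cong)
qed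

lemma ent_times_funit: "ent (A * funit k l) i j = (if j = l then ent A i k else 0)"
proof -
  have "dims (Suc k) (Suc l) (funit k l)" by (rule dims_funit) auto
  then show ?thesis by (simp add: ent_times' if_distrib[of "\<lambda>x. _ * x"] cong: if_cong)
qed

lemma funit_times_funit [simp]: "funit i j * funit k l = (if j = k then funit i l else 0)"
  by (rule fmat_eqI) (auto simp: ent_funit_times)

lemma funit_times_times_funit: "funit i j * (A * funit k l) = ent A j k *\<^sub>C funit i l"
  by (rule fmat_eqI) (auto simp: ent_funit_times ent_times_funit)

lemma fid_eq_sum: "fid n = (\<Sum>i<n. funit i i)"
proof (rule fmat_eqI)
  fix i j
  have "(\<Sum>x<n. if i = x \<and> j = x then 1 else 0) = (\<Sum>x<n. if i = x then (if j = i then 1 else (0::complex)) else 0)"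
    by (rule sum.cong) auto
  then show "ent (fid n) i j = ent (\<Sum>i<n. funit i i) i j" by auto
qed

section \<open>Trace and positivity\<close>

definition ftr :: "nat \<Rightarrow> fmat \<Rightarrow> complex" where
  "ftr n A = (\<Sum>i<n. ent A i i)"

lemma ftr_cyclic:
  assumes "dims n m A" "dims m n B"
  shows "ftr n (A * B) = ftr m (B * A)"
  unfolding ftr_def ent_times[OF assms(1)] ent_times[OF assms(2)]
  by (subst sum.swap) (simp add: mult.commute)

lemma ftr_sum: "ftr n (sum f I) = (\<Sum>x\<in>I. ftr n (f x))"
  unfolding ftr_def ent_sum by (rule sum.swap)

text \<open>The diagonal entries of the sum are sums of squared moduli of the entries of the
  \<open>f x\<close>. Operator identities such as the intertwining relation are obtained by applying
  this to the difference of the two sides.\<close>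

lemma sum_times_fadj_eq_0:
  assumes "finite I" "(\<Sum>x\<in>I. f x * (f x)\<^sup>\<dagger>) = 0" "x \<in> I"
  shows "f x = 0"
proof (rule fmat_eqI)
  fix i j
  \<comment> \<open>Finiteness of \<open>I\<close> gives one size for all \<open>f x\<close>, so
    that all products become sums over the same range.\<close>
  have "\<exists>N. \<forall>x\<in>I. dims N N (f x)" using assms(1)
  proof (induction)
    case (insert x I)
    then obtain N where N: "\<forall>x\<in>I. dims N N (f x)" by blast
    obtain M where "dims M M (f x)" using dims_exists by blast
    with N show ?case by (intro exI[of _ "max M N"]) (auto intro: dims_mono)
  qed auto
  then obtain N where N: "\<And>x. x \<in> I \<Longrightarrow> dims N N (f x)" by blast
  have "0 = ent (\<Sum>x\<in>I. f x * (f x)\<^sup>\<dagger>) i i" using assms(2) by simp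
  also have "\<dots> = (\<Sum>x\<in>I. \<Sum>k<N. ent (f x) i k * cnj (ent (f x) i k))"
    unfolding ent_sum by (rule sum.cong) (auto simp: ent_times[OF N])
  also have "\<dots> = of_real (\<Sum>x\<in>I. \<Sum>k<N. (cmod (ent (f x) i k))\<^sup>2)"
    by (simp only: of_real_sum complex_norm_square)
  finally have "complex_of_real (\<Sum>x\<in>I. \<Sum>k<N. (cmod (ent (f x) i k))\<^sup>2) = 0" by (rule sym)
  then have "(\<Sum>x\<in>I. \<Sum>k<N. (cmod (ent (f x) i k))\<^sup>2) = 0" by (rule of_real_eq_0_iff[THEN iffD1])
  then have "\<forall>x\<in>I. (\<Sum>k<N. (cmod (ent (f x) i k))\<^sup>2) = 0"
    by (subst (asm) sum_nonneg_eq_0_iff) (auto simp: assms(1) intro: sum_nonneg)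
  then have "\<forall>k<N. ent (f x) i k = 0"
    using assms(3) by (auto simp: sum_nonneg_eq_0_iff)
  then show "ent (f x) i j = ent 0 i j"
    using dimsD[OF N[OF assms(3)], of i j] by (cases "j < N") auto
qed

section \<open>Passage between complex matrices and finitely supported ones\<close>

lift_definition fm :: "complex mat \<Rightarrow> fmat"
  is "\<lambda>A i j. if i < dim_row A \<and> j < dim_col A then A $$ (i,j) else 0"
  subgoal for A by (rule exI[of _ "max (dim_row A) (dim_col A)"]) auto
  done

definition mf :: "nat \<Rightarrow> nat \<Rightarrow> fmat \<Rightarrow> complex mat" where
  "mf n m A = mat n m (\<lambda>(i,j). ent A i j)"

lemma ent_fm: "ent (fm A) i j = (if i < dim_row A \<and> j < dim_col A then A $$ (i,j) else 0)"
  by (transfer; simp)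

lemma mf_carrier [simp]: "mf n m A \<in> carrier_mat n m" by (simp add: mf_def)

lemma dims_fm: "A \<in> carrier_mat n m \<Longrightarrow> dims n m (fm A)" by (auto simp: dims_def ent_fm)

lemma fm_mf: "dims n m A \<Longrightarrow> fm (mf n m A) = A"
  by (rule fmat_eqI) (auto simp: ent_fm mf_def dims_def)

lemma mf_fm: "A \<in> carrier_mat n m \<Longrightarrow> mf n m (fm A) = A"
  by (rule eq_matI) (auto simp: ent_fm mf_def)

lemma fm_inject: "A \<in> carrier_mat n m \<Longrightarrow> B \<in> carrier_mat n m \<Longrightarrow> fm A = fm B \<Longrightarrow> A = B"
  by (metis mf_fm)

lemma fm_plus: "A \<in> carrier_mat n m \<Longrightarrow> B \<in> carrier_mat n m \<Longrightarrow> fm (A + B) = fm A + fm B"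
  by (rule fmat_eqI) (auto simp: ent_fm)

lemma fm_smult: "fm (c \<cdot>\<^sub>m A) = c *\<^sub>C fm A"
  by (rule fmat_eqI) (auto simp: ent_fm)

lemma fm_adj: "fm (adj A) = (fm A)\<^sup>\<dagger>"
  by (rule fmat_eqI) (auto simp: ent_fm adj_def)

lemma fm_one: "fm (1\<^sub>m n) = fid n"
  by (rule fmat_eqI) (auto simp: ent_fm)

lemma fm_zero: "fm (0\<^sub>m n m) = 0"
  by (rule fmat_eqI) (auto simp: ent_fm)

lemma fm_times: "A \<in> carrier_mat n m \<Longrightarrow> B \<in> carrier_mat m k \<Longrightarrow> fm (A * B) = fm A * fm B"
  by (rule fmat_eqI)
     (auto simp: ent_times[OF dims_fm] ent_fm scalar_prod_def lessThan_atLeast0)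

lemma adj_carrier: "A \<in> carrier_mat n m \<Longrightarrow> adj A \<in> carrier_mat m n"
  by (auto simp: adj_def)

lemma mtrace_eq_ftr: "A \<in> carrier_mat n n \<Longrightarrow> mtrace A = ftr n (fm A)"
  by (auto simp: mtrace_def ftr_def ent_fm)

section \<open>Kraus decompositions\<close>

text \<open>Induction on the size, eliminating the last index as in a Cholesky factorisation. If the
  last diagonal entry \<open>c\<close> is zero, positivity kills the last row and column; otherwise
  the Schur complement is again positive, and the last column divided by the square root of
  \<open>c\<close> supplies the missing vector.\<close>

lemma psd_form_decomp:
  fixes f :: "nat \<Rightarrow> nat \<Rightarrow> complex"
  assumes "\<And>r s. r < N \<Longrightarrow> s < N \<Longrightarrow> f s r = cnj (f r s)"
    and "\<And>v. 0 \<le> Re (\<Sum>i<N. \<Sum>j<N. cnj (v i) * f i j * v j)"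
  shows "\<exists>w. \<forall>r<N. \<forall>s<N. f r s = (\<Sum>k<N. w k r * cnj (w k s))"
  using assms
proof (induction N arbitrary: f)
  case 0
  then show ?case by simp
next
  case (Suc N)
  note herm = Suc.prems(1)
  define c where "c = Re (f N N)"
  have fNN: "f N N = of_real c"
    using herm[of N N] unfolding c_def by (simp add: complex_eq_iff)
  define l where "l = (\<lambda>v. \<Sum>j<N. f N j * v j)"
  define Q where "Q = (\<lambda>v. \<Sum>i<N. \<Sum>j<N. cnj (v i) * f i j * v j)"
  have lc: "(\<Sum>i<N. cnj (v i) * f i N) = cnj (l v)" for v
    unfolding l_def cnj_sum by (rule sum.cong) (auto simp: herm[of N])
  \<comment> \<open>The form at a vector with last coordinate \<open>z\<close>, split into the form
    \<open>Q\<close> on the first \<open>N\<close> coordinates and the linear form \<open>l\<close>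
    of the last row. Positivity is exploited below through suitable choices of
    \<open>z\<close>.\<close>
  have ext: "0 \<le> Re (Q v) + 2 * Re (cnj z * l v) + c * (cmod z)\<^sup>2" for v z
  proof -
    let ?u = "v(N := z)"
    have "(\<Sum>i<Suc N. \<Sum>j<Suc N. cnj (?u i) * f i j * ?u j)
        = (\<Sum>i<N. (\<Sum>j<N. cnj (v i) * f i j * v j) + cnj (v i) * f i N * z)
          + ((\<Sum>j<N. cnj z * f N j * v j) + cnj z * f N N * z)"
      by simp
    also have "\<dots> = Q v + cnj (l v) * z + cnj z * l v + c * (z * cnj z)"
      unfolding Q_def lc[symmetric] by (simp add: sum.distrib sum_distrib_left sum_distrib_right l_def fNN algebra_simps)
    also have "\<dots> = Q v + (cnj (cnj z * l v) + cnj z * l v) + of_real (c * (cmod z)\<^sup>2)"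
      by (simp only: complex_norm_square of_real_mult) (simp add: algebra_simps)
    finally show ?thesis using Suc.prems(2)[of ?u] by simp
  qed
  have c0: "c \<ge> 0" using ext[of "\<lambda>_. 0" 1] by (simp add: Q_def l_def)
  show ?case
  proof (cases "c = 0")
    case True
    have z: "f N s = 0" if "s < N" for s
    proof (rule ccontr)
      assume nz: "f N s \<noteq> 0"
      define v where "v = (\<lambda>i. if i = s then 1 else 0 :: complex)"
      have l: "l v = f N s" using that by (simp add: l_def v_def if_distrib[of "\<lambda>x. _ * x"] cong: if_cong)
      \<comment> \<open>With \<open>c = 0\<close> the bound in \<open>ext\<close> is affine in
        \<open>z\<close>. This \<open>M\<close> makes its value at \<open>z = - M * f N s\<close>
        equal to -1.\<close>
      define M where "M = (Re (Q v) + 1) / (2 * (cmod (f N s))\<^sup>2)"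
      have "Re (cnj (- (of_real M * f N s)) * f N s) = - M * (cmod (f N s))\<^sup>2"
        unfolding cmod_power2 by (simp add: power2_eq_square algebra_simps)
      then have "0 \<le> Re (Q v) - 2 * M * (cmod (f N s))\<^sup>2"
        using ext[of v "- (of_real M * f N s)"] unfolding l True by simp
      also have "2 * M * (cmod (f N s))\<^sup>2 = Re (Q v) + 1"
        unfolding M_def using nz by (simp add: field_simps)
      finally show False by simp
    qed
    have z': "f s N = 0" if "s < N" for s using z[OF that] herm[of N s] that by simp
    have "\<exists>w. \<forall>r<N. \<forall>s<N. f r s = (\<Sum>k<N. w k r * cnj (w k s))"
    proof (rule Suc.IH)
      show "0 \<le> Re (\<Sum>i<N. \<Sum>j<N. cnj (v i) * f i j * v j)" for v
        using ext[of v 0] by (simp add: Q_def)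
      show "f s r = cnj (f r s)" if "r < N" "s < N" for r s
        by (rule herm) (use that in simp_all)
    qed
    then obtain w where w: "\<And>r s. r < N \<Longrightarrow> s < N \<Longrightarrow> f r s = (\<Sum>k<N. w k r * cnj (w k s))" by blast
    \<comment> \<open>Padding by zero: vector \<open>N\<close>, and coordinate \<open>N\<close> of
      every vector, vanish like the last row and column of \<open>f\<close>.\<close>
    define w' where "w' = (\<lambda>k r. if k < N \<and> r < N then w k r else 0)"
    have "f r s = (\<Sum>k<Suc N. w' k r * cnj (w' k s))" if "r < Suc N" "s < Suc N" for r s
      using that z z' fNN True w[of r s] by (auto simp: w'_def less_Suc_eq)
    then show ?thesis by blast
  next
    case False
    with c0 have c: "c > 0" by simp
    define g where "g = (\<lambda>i j. f i j - f i N * f N j / c)"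
    have "\<exists>w. \<forall>r<N. \<forall>s<N. g r s = (\<Sum>k<N. w k r * cnj (w k s))"
    proof (rule Suc.IH)
      fix r s assume "r < N" "s < N"
      then show "g s r = cnj (g r s)"
        using herm[of r s] herm[of N s] herm[of r N] by (simp add: g_def mult.commute)
    next
      fix v
      have "(\<Sum>i<N. \<Sum>j<N. cnj (v i) * g i j * v j) = Q v - (\<Sum>i<N. \<Sum>j<N. (cnj (v i) * f i N) * (f N j * v j) / c)"
        unfolding Q_def g_def sum_subtractf[symmetric] by (simp add: algebra_simps)
      also have "(\<Sum>i<N. \<Sum>j<N. (cnj (v i) * f i N) * (f N j * v j) / c) = cnj (l v) * l v / c"
        unfolding lc[symmetric] by (simp add: l_def sum_product sum_divide_distrib)
      also have "cnj (l v) * l v / c = of_real ((cmod (l v))\<^sup>2 / c)"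
        by (simp only: complex_norm_square of_real_divide mult.commute)
      finally have 1: "Re (\<Sum>i<N. \<Sum>j<N. cnj (v i) * g i j * v j) = Re (Q v) - (cmod (l v))\<^sup>2 / c" by simp
      \<comment> \<open>The choice \<open>z = - l v / c\<close> minimises the bound in
        \<open>ext\<close> and leaves exactly the value of the form \<open>g\<close> at
        \<open>v\<close>.\<close>
      have "Re (cnj (- (l v / of_real c)) * l v) = - (cmod (l v))\<^sup>2 / c"
        using c unfolding cmod_power2 by (simp add: power2_eq_square field_simps)
      moreover have "c * (cmod (- (l v / of_real c)))\<^sup>2 = (cmod (l v))\<^sup>2 / c"
        using c by (simp add: norm_divide power_divide power2_eq_square)
      ultimately show "0 \<le> Re (\<Sum>i<N. \<Sum>j<N. cnj (v i) * g i j * v j)"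
        using ext[of v "- (l v / of_real c)"] unfolding 1 by linarith
    qed
    then obtain w where w: "\<And>r s. r < N \<Longrightarrow> s < N \<Longrightarrow> g r s = (\<Sum>k<N. w k r * cnj (w k s))" by blast
    \<comment> \<open>The new vector reproduces the last row and column by itself, so all others get
      coordinate 0 at \<open>N\<close>.\<close>
    define w' where "w' = (\<lambda>k r. if k < N then (if r < N then w k r else 0) else f r N / sqrt c)"
    have sq: "complex_of_real (sqrt c) * complex_of_real (sqrt c) = c"
      using c by (simp flip: of_real_mult)
    have "f r s = (\<Sum>k<Suc N. w' k r * cnj (w' k s))" if "r < Suc N" "s < Suc N" for r s
    proof -
      have "(\<Sum>k<Suc N. w' k r * cnj (w' k s)) = (\<Sum>k<N. w' k r * cnj (w' k s)) + f r N * f N s / c"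
        using herm[of s N] that by (simp add: w'_def sq)
      also have "(\<Sum>k<N. w' k r * cnj (w' k s)) = f r s - f r N * f N s / c"
      proof (cases "r < N \<and> s < N")
        case True
        then show ?thesis using w[of r s] by (simp add: w'_def g_def)
      next
        case False
        then have "r = N \<or> s = N" using that by auto
        then show ?thesis using c by (auto simp: w'_def fNN)
      qed
      finally show ?thesis by simp
    qed
    then show ?thesis by blast
  qed
qed

text \<open>The normalisation expresses trace preservation. The index type is free because the
  recovery channel below is indexed by a disjoint union.\<close>

definition kraus :: "nat \<Rightarrow> 'i set \<Rightarrow> ('i \<Rightarrow> fmat) \<Rightarrow> bool" where
  "kraus n I K \<longleftrightarrow> finite I \<and> (\<forall>k\<in>I. dims n n (K k)) \<and> (\<Sum>k\<in>I. (K k)\<^sup>\<dagger> * K k) = fid n"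

lemma index_less: "i < k \<Longrightarrow> p < n \<Longrightarrow> i * n + p < k * (n::nat)"
  using mult_le_mono1[of "Suc i" k n] by simp

text \<open>Choi's argument: the ampliation of order \<open>n\<close> is applied to the unnormalised
  maximally entangled matrix. The blocks of the result are the values of \<open>E\<close> at the
  matrix units, which determine \<open>E\<close> by linearity.\<close>

lemma quantum_channel_kraus:
  assumes "quantum_channel n E"
  obtains r :: nat and K where "kraus n {..<r} K"
    "\<And>A. A \<in> carrier_mat n n \<Longrightarrow> fm (E A) = (\<Sum>k<r. K k * fm A * (K k)\<^sup>\<dagger>)"
proof -
  have lin: "lin_map n n E" and cp: "completely_positive n E" and tp: "trace_preserving n E"
    using assms by (auto simp: quantum_channel_def)
  have Ec: "E A \<in> carrier_mat n n" if "A \<in> carrier_mat n n" for A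
    using lin that by (simp add: lin_map_def)
  define Ef where "Ef X = fm (E (mf n n X))" for X
  have mf_add: "mf n n (X + Y) = mf n n X + mf n n Y" for X Y by (rule eq_matI) (auto simp: mf_def)
  have mf_smul: "mf n n (c *\<^sub>C X) = c \<cdot>\<^sub>m mf n n X" for c X by (rule eq_matI) (auto simp: mf_def)
  have Ef_add: "Ef (X + Y) = Ef X + Ef Y" for X Y
    using lin Ec by (simp add: Ef_def mf_add lin_map_def fm_plus[of _ n n])
  have Ef_smul: "Ef (c *\<^sub>C X) = c *\<^sub>C Ef X" for c X
    using lin by (simp add: Ef_def mf_smul lin_map_def fm_smult)
  have Ef_0: "Ef 0 = 0" using Ef_smul[of 0 0] by simp
  have Ef_sum: "Ef (sum h I) = (\<Sum>x\<in>I. Ef (h x))" for h and I :: "nat set"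
    by (induction I rule: infinite_finite_induct) (auto simp: Ef_0 Ef_add)
  \<comment> \<open>Up to scaling, the projection onto the sum of the vectors e_i \<otimes> e_i: an
    index \<open>r\<close> with block \<open>i\<close> and position \<open>p\<close> contributes
    exactly if i = p.\<close>
  define Om where "Om = mat (n*n) (n*n) (\<lambda>(r,s). if r div n = r mod n \<and> s div n = s mod n then 1 else 0 :: complex)"
  have psdOm: "psd (n*n) Om"
    unfolding psd_def
  proof (intro conjI allI)
    show "Om \<in> carrier_mat (n*n) (n*n)" by (simp add: Om_def)
    show "adj Om = Om" by (rule eq_matI) (auto simp: Om_def adj_def)
    fix v :: "nat \<Rightarrow> complex"
    define d where "d r = (if r div n = r mod n then 1 else 0 :: complex)" for r
    have "(\<Sum>i<n*n. \<Sum>j<n*n. cnj (v i) * Om $$ (i,j) * v j)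
        = (\<Sum>i<n*n. \<Sum>j<n*n. cnj (d i * v i) * (d j * v j))"
      by (intro sum.cong refl) (auto simp: Om_def d_def)
    also have "\<dots> = (\<Sum>j<n*n. d j * v j) * cnj (\<Sum>j<n*n. d j * v j)"
      by (simp only: cnj_sum sum_product) (rule sum.swap[THEN trans], simp add: mult.commute)
    also have "\<dots> = of_real ((cmod (\<Sum>j<n*n. d j * v j))\<^sup>2)" by (simp only: complex_norm_square)
    finally show "0 \<le> Re (\<Sum>i<n*n. \<Sum>j<n*n. cnj (v i) * Om $$ (i,j) * v j)" by simp
  qed
  define C where "C = ampliate n n E Om"
  have C: "psd (n*n) C" using cp psdOm unfolding completely_positive_def C_def by blast
  have Cent: "C $$ (i*n+p, j*n+q) = ent (Ef (funit i j)) p q" if "i < n" "j < n" "p < n" "q < n" for i j p q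
  proof -
    have "mat n n (\<lambda>(p',q'). Om $$ (((i*n+p) div n) * n + p', ((j*n+q) div n) * n + q')) = mf n n (funit i j)"
      using that index_less[of i n _ n] index_less[of j n _ n] by (intro eq_matI) (auto simp: Om_def mf_def)
    then show ?thesis using that index_less[of i n p n] index_less[of j n q n] Ec[of "mf n n (funit i j)"]
      by (simp add: C_def ampliate_def Ef_def ent_fm)
  qed
  have "\<exists>w. \<forall>r<n*n. \<forall>s<n*n. C $$ (r,s) = (\<Sum>k<n*n. w k r * cnj (w k s))"
  proof (rule psd_form_decomp)
    fix r s assume "r < n*n" "s < n*n"
    moreover have "C \<in> carrier_mat (n*n) (n*n)" using C by (simp add: psd_def)
    ultimately have "adj C $$ (s,r) = cnj (C $$ (r,s))" unfolding adj_def by auto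
    then show "C $$ (s,r) = cnj (C $$ (r,s))" using C by (simp add: psd_def)
  qed (use C in \<open>simp add: psd_def\<close>)
  then obtain w where w: "\<And>r s. r < n*n \<Longrightarrow> s < n*n \<Longrightarrow> C $$ (r,s) = (\<Sum>k<n*n. w k r * cnj (w k s))" by blast
  \<comment> \<open>Each vector of length \<open>n*n\<close> is folded into a matrix whose column
    \<open>i\<close> is its \<open>i\<close>-th segment. The factorisation of \<open>C\<close>
    thereby becomes the Kraus form on matrix units.\<close>
  define K where "K k = mat n n (\<lambda>(p,i). w k (i*n+p))" for k
  have dK: "dims n n (fm (K k))" for k by (rule dims_fm) (simp add: K_def)
  have eK: "ent (fm (K k)) p i = w k (i*n+p)" if "p < n" "i < n" for k p i
    using that by (simp add: ent_fm K_def)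
  have entEf: "ent (Ef (funit i j)) p q = (\<Sum>k<n*n. ent (fm (K k)) p i * cnj (ent (fm (K k)) q j))"
    if "i < n" "j < n" "p < n" "q < n" for i j p q
    using Cent[OF that] w[of "i*n+p" "j*n+q"] that index_less[of i n p n] index_less[of j n q n] eK by simp
  have main: "fm (E A) = (\<Sum>k<n*n. fm (K k) * fm A * (fm (K k))\<^sup>\<dagger>)" if A: "A \<in> carrier_mat n n" for A
  proof (rule fmat_dims_eqI)
    show "dims n n (fm (E A))" by (rule dims_fm[OF Ec[OF A]])
    show "dims n n (\<Sum>k<n*n. fm (K k) * fm A * (fm (K k))\<^sup>\<dagger>)"
      by (rule dims_fm[OF A] dK dims_intros)+
    fix p q assume True: "p < n" "q < n"
    have dec: "fm A = (\<Sum>i<n. \<Sum>j<n. ent (fm A) i j *\<^sub>C funit i j)"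
    proof (rule fmat_eqI)
      fix p q
      have "(\<Sum>i<n. \<Sum>j<n. ent (fm A) i j * (if p = i \<and> q = j then 1 else 0))
          = (\<Sum>i<n. if p = i then (\<Sum>j<n. if q = j then ent (fm A) i j else 0) else 0)"
        by (intro sum.cong refl) (auto simp: if_distrib[of "\<lambda>x. _ * x"] cong: if_cong)
      also have "\<dots> = ent (fm A) p q" using dimsD[OF dims_fm[OF A], of p q] by auto
      finally show "ent (fm A) p q = ent (\<Sum>i<n. \<Sum>j<n. ent (fm A) i j *\<^sub>C funit i j) p q" by simp
    qed
    have "fm (E A) = Ef (fm A)" using A by (simp add: Ef_def mf_fm)
    also have "\<dots> = (\<Sum>i<n. \<Sum>j<n. ent (fm A) i j *\<^sub>C Ef (funit i j))"
      by (subst dec) (simp only: Ef_sum Ef_smul)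
    finally have "ent (fm (E A)) p q = (\<Sum>i<n. \<Sum>j<n. \<Sum>k<n*n. ent (fm A) i j * (ent (fm (K k)) p i * cnj (ent (fm (K k)) q j)))"
      using True by (simp add: entEf sum_distrib_left)
    also have "\<dots> = (\<Sum>k<n*n. \<Sum>i<n. \<Sum>j<n. ent (fm A) i j * (ent (fm (K k)) p i * cnj (ent (fm (K k)) q j)))"
      by (rule trans[OF sum.cong[OF refl sum.swap] sum.swap])
    also have "\<dots> = (\<Sum>k<n*n. ent (fm (K k) * fm A * (fm (K k))\<^sup>\<dagger>) p q)"
    proof (rule sum.cong[OF refl])
      fix k
      show "(\<Sum>i<n. \<Sum>j<n. ent (fm A) i j * (ent (fm (K k)) p i * cnj (ent (fm (K k)) q j)))
          = ent (fm (K k) * fm A * (fm (K k))\<^sup>\<dagger>) p q"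
        unfolding ent_times'[OF dims_fadj[OF dK]] ent_times[OF dK]
        by (subst sum.swap, simp only: sum_distrib_right ent_fadj, simp only: ac_simps)
    qed
    finally show "ent (fm (E A)) p q = ent (\<Sum>k<n*n. fm (K k) * fm A * (fm (K k))\<^sup>\<dagger>) p q" by simp
  qed
  have "(\<Sum>k<n*n. (fm (K k))\<^sup>\<dagger> * fm (K k)) = fid n"
  proof (rule fmat_dims_eqI)
    show "dims n n (\<Sum>k<n*n. (fm (K k))\<^sup>\<dagger> * fm (K k))" by (rule dK dims_intros)+
    fix j i assume True: "j < n" "i < n"
    \<comment> \<open>Entry (j,i) of the sum is the trace of \<open>E\<close> at
      \<open>funit i j\<close>, which trace preservation reduces to the trace of that unit.\<close>
    have "ent (\<Sum>k<n*n. (fm (K k))\<^sup>\<dagger> * fm (K k)) j i = (\<Sum>p<n. ent (Ef (funit i j)) p p)"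
      using True by (simp add: entEf ent_times'[OF dK] mult.commute) (rule sum.swap)
    also have "\<dots> = mtrace (E (mf n n (funit i j)))"
      by (simp add: Ef_def mtrace_eq_ftr[OF Ec[OF mf_carrier]] ftr_def)
    also have "\<dots> = mtrace (mf n n (funit i j))" using tp by (simp add: trace_preserving_def)
    also have "\<dots> = (\<Sum>k<n. if k = i then (if i = j then 1 else 0) else 0)"
      unfolding mtrace_def by (rule sum.cong) (auto simp: mf_def)
    finally show "ent (\<Sum>k<n*n. (fm (K k))\<^sup>\<dagger> * fm (K k)) j i = ent (fid n) j i"
      using True by auto
  qed simp
  then have "kraus n {..<n*n} (\<lambda>k. fm (K k))" by (simp add: kraus_def dK)
  then show ?thesis using main that by blast
qed

section \<open>Kraus families define quantum channels\<close>

lemma sum_index_split: "(\<Sum>t<k * n. g t) = (\<Sum>i<k. \<Sum>p<n. g (i * n + p :: nat))"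
proof -
  have "(\<Sum>t<k * n. g t) = (\<Sum>i<k. sum g {i * n..<i * n + n})"
    by (rule sum.nat_group[symmetric])
  also have "\<dots> = (\<Sum>i<k. \<Sum>p<n. g (i * n + p))"
  proof (rule sum.cong[OF refl])
    fix i
    show "sum g {i * n..<i * n + n} = (\<Sum>p<n. g (i * n + p))"
      using sum.shift_bounds_nat_ivl[of g 0 "i * n" n] by (simp add: lessThan_atLeast0 add.commute)
  qed
  finally show ?thesis .
qed

lemma psd_form:
  assumes "A \<in> carrier_mat N N" "dims N 1 u"
  shows "ent (u\<^sup>\<dagger> * fm A * u) 0 0 = (\<Sum>i<N. \<Sum>j<N. cnj (ent u i 0) * A $$ (i,j) * ent u j 0)"
proof -
  have "ent (u\<^sup>\<dagger> * fm A * u) 0 0 = (\<Sum>j<N. \<Sum>i<N. cnj (ent u i 0) * ent (fm A) i j * ent u j 0)"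
    by (simp add: ent_times'[OF assms(2)] ent_times'[OF dims_fm[OF assms(1)]] sum_distrib_right)
  also have "\<dots> = (\<Sum>i<N. \<Sum>j<N. cnj (ent u i 0) * A $$ (i,j) * ent u j 0)"
    using assms(1) by (subst sum.swap) (auto simp: ent_fm intro!: sum.cong)
  finally show ?thesis .
qed

text \<open>Conjugation moves onto the test vector: the form of
  \<open>L x * fm M * (L x)\<^sup>\<dagger>\<close> at \<open>u\<close> is the form of
  \<open>M\<close> at \<open>(L x)\<^sup>\<dagger> * u\<close>.\<close>

lemma psd_kraus:
  assumes M: "psd N M" and A: "A \<in> carrier_mat N N" and L: "\<And>x. x \<in> I \<Longrightarrow> dims N N (L x)"
    and eq: "fm A = (\<Sum>x\<in>I. L x * fm M * (L x)\<^sup>\<dagger>)"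
  shows "psd N A"
  unfolding psd_def
proof (intro conjI allI)
  have Mc: "M \<in> carrier_mat N N" and "adj M = M" using M by (auto simp: psd_def)
  then have "(fm M)\<^sup>\<dagger> = fm M" by (metis fm_adj)
  then have "fm (adj A) = fm A" by (simp add: fm_adj eq mult.assoc)
  then show "adj A = A" using A by (intro fm_inject[of _ N N]) (auto intro: adj_carrier)
  fix v :: "nat \<Rightarrow> complex"
  \<comment> \<open>The test vector as a column, so that the form becomes a product in the ring;
    coordinates of \<open>v\<close> from \<open>N\<close> on do not enter.\<close>
  define u where "u = (\<Sum>j<N. v j *\<^sub>C funit j 0)"
  have u: "dims N 1 u" unfolding u_def by (rule dims_intros | simp)+
  have v: "ent u i 0 = v i" if "i < N" for i
    using that by (simp add: u_def if_distrib[of "\<lambda>x. _ * x"] cong: if_cong)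
  have nn: "0 \<le> Re (ent (w\<^sup>\<dagger> * fm M * w) 0 0)" if "dims N 1 w" for w
    unfolding psd_form[OF Mc that] using M by (simp only: psd_def)
  have "(\<Sum>i<N. \<Sum>j<N. cnj (v i) * A $$ (i,j) * v j) = ent (u\<^sup>\<dagger> * fm A * u) 0 0"
    by (simp add: psd_form[OF A u] v)
  also have "\<dots> = (\<Sum>x\<in>I. ent (((L x)\<^sup>\<dagger> * u)\<^sup>\<dagger> * fm M * ((L x)\<^sup>\<dagger> * u)) 0 0)"
    by (simp add: eq sum_distrib_left sum_distrib_right mult.assoc)
  also have "Re \<dots> = (\<Sum>x\<in>I. Re (ent (((L x)\<^sup>\<dagger> * u)\<^sup>\<dagger> * fm M * ((L x)\<^sup>\<dagger> * u)) 0 0))" by (rule Re_sum)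
  also have "\<dots> \<ge> 0"
    by (intro sum_nonneg nn) (rule L u dims_intros | assumption)+
  finally show "0 \<le> Re (\<Sum>i<N. \<Sum>j<N. cnj (v i) * A $$ (i,j) * v j)" .
qed (rule A)

text \<open>Trace preservation is cyclicity of the trace together with the normalisation. The
  ampliation of order \<open>k\<close> has Kraus operators I_k \<otimes> \<open>K x\<close>, so
  complete positivity follows from \<open>psd_kraus\<close>.\<close>

lemma kraus_quantum_channel:
  assumes "kraus n I K"
  shows "quantum_channel n (\<lambda>A. mf n n (\<Sum>k\<in>I. K k * fm A * (K k)\<^sup>\<dagger>))" (is "quantum_channel n ?E")
  unfolding quantum_channel_def
proof (intro conjI)
  have dK: "dims n n (K k)" if "k \<in> I" for k using assms that by (simp add: kraus_def)
  have KK: "(\<Sum>k\<in>I. (K k)\<^sup>\<dagger> * K k) = fid n" using assms by (simp add: kraus_def)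
  have dsum: "dims n n (\<Sum>k\<in>I. K k * fm A * (K k)\<^sup>\<dagger>)" if "A \<in> carrier_mat n n" for A
    by (rule dims_fm[OF that] dK dims_intros | assumption)+
  show "lin_map n n ?E"
    unfolding lin_map_def
  proof (intro conjI ballI allI)
    fix A B :: "complex mat" and c
    assume A: "A \<in> carrier_mat n n"
    show "?E A \<in> carrier_mat n n" by simp
    show "?E (c \<cdot>\<^sub>m A) = c \<cdot>\<^sub>m ?E A"
      by (rule eq_matI) (auto simp: mf_def fm_smult sum_distrib_left)
    assume B: "B \<in> carrier_mat n n"
    show "?E (A + B) = ?E A + ?E B"
      by (rule eq_matI) (auto simp: mf_def fm_plus[OF A B] algebra_simps sum.distrib)
  qed
  show "trace_preserving n ?E"
    unfolding trace_preserving_def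
  proof
    fix A :: "complex mat" assume A: "A \<in> carrier_mat n n"
    have "mtrace (?E A) = (\<Sum>k\<in>I. ftr n (K k * fm A * (K k)\<^sup>\<dagger>))"
      by (simp add: mtrace_eq_ftr[of _ n] fm_mf[OF dsum[OF A]] ftr_sum)
    also have "\<dots> = (\<Sum>k\<in>I. ftr n ((K k)\<^sup>\<dagger> * K k * fm A))"
      unfolding mult.assoc[of "_\<^sup>\<dagger>"]
      by (rule sum.cong[OF refl], rule ftr_cyclic) (rule dims_fm[OF A] dK dims_intros | assumption)+
    also have "\<dots> = ftr n (fid n * fm A)" by (simp add: ftr_sum[symmetric] sum_distrib_right[symmetric] KK)
    also have "\<dots> = mtrace A" by (simp add: fid_times[OF dims_fm[OF A]] mtrace_eq_ftr[OF A])
    finally show "mtrace (?E A) = mtrace A" .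
  qed
  show "completely_positive n ?E"
    unfolding completely_positive_def
  proof (intro allI impI)
    fix k :: nat and M assume M: "psd (k * n) M"
    then have Mc: "M \<in> carrier_mat (k * n) (k * n)" by (simp add: psd_def)
    \<comment> \<open>This is I_k \<otimes> \<open>K x\<close>, with a copy of \<open>K x\<close> in
      every diagonal block.\<close>
    define L where "L x = fm (mat (k*n) (k*n) (\<lambda>(r,t). if r div n = t div n then ent (K x) (r mod n) (t mod n) else 0))" for x
    have dL: "dims (k*n) (k*n) (L x)" for x unfolding L_def by (rule dims_fm) simp
    have Lt: "ent (L x * B) r s = (\<Sum>a<n. ent (K x) (r mod n) a * ent B ((r div n) * n + a) s)"
      if r: "r < k * n" for x B r s
    proof -
      have rk: "r div n < k" using r by (simp add: less_mult_imp_div_less)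
      have "ent (L x * B) r s = (\<Sum>i<k. \<Sum>a<n. ent (L x) r (i*n+a) * ent B (i*n+a) s)"
        by (simp add: ent_times[OF dL] sum_index_split)
      also have "\<dots> = (\<Sum>i<k. if r div n = i then \<Sum>a<n. ent (K x) (r mod n) a * ent B (i*n+a) s else 0)"
        using r index_less by (intro sum.cong refl) (auto simp: L_def ent_fm intro!: sum.neutral sum.cong)
      also have "\<dots> = (\<Sum>a<n. ent (K x) (r mod n) a * ent B ((r div n) * n + a) s)"
        using rk by simp
      finally show ?thesis .
    qed
    have Lt': "ent (B * (L x)\<^sup>\<dagger>) r s = (\<Sum>a<n. ent B r ((s div n) * n + a) * cnj (ent (K x) (s mod n) a))"
      if s: "s < k * n" for x B r s
    proof -
      have "ent (B * (L x)\<^sup>\<dagger>) r s = cnj (ent (L x * B\<^sup>\<dagger>) s r)" by (simp flip: ent_fadj)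
      then show ?thesis by (simp add: Lt[OF s] mult.commute)
    qed
    show "psd (k * n) (ampliate k n ?E M)"
    proof (rule psd_kraus[OF M _ dL])
      show Ac: "ampliate k n ?E M \<in> carrier_mat (k * n) (k * n)" by (simp add: ampliate_def)
      show "fm (ampliate k n ?E M) = (\<Sum>x\<in>I. L x * fm M * (L x)\<^sup>\<dagger>)"
      proof (rule fmat_dims_eqI)
        show "dims (k*n) (k*n) (fm (ampliate k n ?E M))" by (rule dims_fm[OF Ac])
        show "dims (k*n) (k*n) (\<Sum>x\<in>I. L x * fm M * (L x)\<^sup>\<dagger>)"
          by (rule dims_fm[OF Mc] dL dims_intros | assumption)+
        fix r s assume r: "r < k * n" and s: "s < k * n"
        have n: "n > 0" using r by (cases n) auto
        have rk: "r div n < k" and sk: "s div n < k" using r s by (simp_all add: less_mult_imp_div_less)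
        define B where "B = mat n n (\<lambda>(p,q). M $$ ((r div n) * n + p, (s div n) * n + q))"
        have dB: "dims n n (fm B)" by (rule dims_fm) (simp add: B_def)
        have "ent (fm (ampliate k n ?E M)) r s = ent (\<Sum>x\<in>I. K x * fm B * (K x)\<^sup>\<dagger>) (r mod n) (s mod n)"
          using r s n by (simp add: ent_fm ampliate_def B_def[symmetric] mf_def)
        also have "\<dots> = (\<Sum>x\<in>I. ent (L x * fm M * (L x)\<^sup>\<dagger>) r s)"
          unfolding ent_sum
        proof (rule sum.cong[OF refl])
          fix x assume "x \<in> I"
          show "ent (K x * fm B * (K x)\<^sup>\<dagger>) (r mod n) (s mod n) = ent (L x * fm M * (L x)\<^sup>\<dagger>) r s"
            unfolding ent_times'[OF dims_fadj[OF dK[OF \<open>x \<in> I\<close>]]] Lt'[OF s] Lt[OF r] ent_times[OF dK[OF \<open>x \<in> I\<close>]] ent_fadj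
            using Mc index_less[OF rk] index_less[OF sk]
            by (intro sum.cong refl arg_cong2[where f = "(*)"]) (auto simp: ent_fm B_def)
        qed
        finally show "ent (fm (ampliate k n ?E M)) r s = ent (\<Sum>x\<in>I. L x * fm M * (L x)\<^sup>\<dagger>) r s" by simp
      qed
    qed
  qed
qed

section \<open>Block embeddings and orthonormal families of isometries\<close>

text \<open>\<open>blk m a\<close> is \<open>|a\<rangle> \<otimes> I\<^sub>m\<close>, so that \<open>emb k m Y\<close> below is \<open>I\<^sub>k \<otimes> Y\<close>.\<close>

definition blk :: "nat \<Rightarrow> nat \<Rightarrow> fmat" where
  "blk m a = (\<Sum>b<m. funit (a * m + b) b)"

lemma dims_blk: "a < k \<Longrightarrow> dims (k * m) m (blk m a)"
  unfolding blk_def by (intro dims_sum dims_funit index_less) auto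

lemma index_eq_iff: "b < m \<Longrightarrow> r = a * m + b \<longleftrightarrow> r div m = a \<and> r mod m = (b::nat)"
  by (metis div_mult_mod_eq div_mult_self3 mod_mult_self3 div_less mod_less add_0_right less_nat_zero_code not_gr_zero)

text \<open>The guard covers \<open>m = 0\<close>, where \<open>r div m\<close> is 0 and would
  select \<open>a = 0\<close> although \<open>blk m a\<close> is zero.\<close>

lemma ent_blk_times:
  "ent (blk m a * X) r s = (if m > 0 \<and> r div m = a then ent X (r mod m) s else 0)"
proof -
  have "ent (blk m a * X) r s = (\<Sum>b<m. if r = a * m + b then ent X b s else 0)"
    by (simp add: blk_def sum_distrib_right ent_funit_times)
  also have "\<dots> = (\<Sum>b<m. if b = r mod m then (if r div m = a then ent X b s else 0) else 0)"
    by (rule sum.cong) (auto simp: index_eq_iff)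
  finally show ?thesis by simp
qed

lemma ent_times_blk_fadj:
  "ent (X * (blk m a)\<^sup>\<dagger>) r s = (if m > 0 \<and> s div m = a then ent X r (s mod m) else 0)"
proof -
  have "ent (X * (blk m a)\<^sup>\<dagger>) r s = cnj (ent (blk m a * X\<^sup>\<dagger>) s r)" by (simp flip: ent_fadj)
  then show ?thesis by (simp add: ent_blk_times)
qed

lemma ent_blk_fadj_times: "ent ((blk m a)\<^sup>\<dagger> * X) b s = (if b < m then ent X (a * m + b) s else 0)"
  by (simp add: blk_def sum_distrib_right ent_funit_times)

lemma ent_times_blk: "ent (X * blk m a) r b = (if b < m then ent X r (a * m + b) else 0)"
  by (simp add: blk_def sum_distrib_left ent_times_funit)

lemma blk_fadj_times_blk: "(blk m a)\<^sup>\<dagger> * blk m a' = (if a = a' then fid m else 0)"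
proof (rule fmat_eqI)
  fix b c
  have "ent ((blk m a)\<^sup>\<dagger> * blk m a') b c = (\<Sum>x<m. if b < m \<and> a * m + b = a' * m + x \<and> c = x then 1 else 0)"
    by (simp add: ent_blk_fadj_times) (simp add: blk_def)
  also have "\<dots> = (\<Sum>x<m. if x = c then (if b < m \<and> a = a' \<and> b = c then 1 else 0) else 0)"
    by (rule sum.cong) (auto simp: index_eq_iff)
  finally show "ent ((blk m a)\<^sup>\<dagger> * blk m a') b c = ent (if a = a' then fid m else 0) b c" by auto
qed

lemma sum_blk_blk_fadj: "(\<Sum>a<k. blk m a * (blk m a)\<^sup>\<dagger>) = fid (k * m)"
proof (rule fmat_dims_eqI)
  show "dims (k * m) (k * m) (\<Sum>a<k. blk m a * (blk m a)\<^sup>\<dagger>)"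
    by (rule dims_blk dims_intros | simp)+
  fix r s assume "r < k * m" "s < k * m"
  then have m: "m > 0" and rk: "r div m < k" by (auto intro: Nat.gr0I simp: less_mult_imp_div_less)
  have "ent (\<Sum>a<k. blk m a * (blk m a)\<^sup>\<dagger>) r s = (\<Sum>a<k. if a = r div m then ent ((blk m a)\<^sup>\<dagger>) (r mod m) s else 0)"
    using m by (auto simp: ent_blk_times simp del: ent_fadj intro!: sum.cong)
  also have "\<dots> = ent (fid m * (blk m (r div m))\<^sup>\<dagger>) (r mod m) s"
    using rk dims_blk[of "r div m" k m] by (simp add: fid_times[OF dims_fadj] del: ent_fadj)
  also have "\<dots> = (if r = s then 1 else 0)"
    using m unfolding ent_times_blk_fadj by auto (metis div_mult_mod_eq)
  finally show "ent (\<Sum>a<k. blk m a * (blk m a)\<^sup>\<dagger>) r s = ent (fid (k * m)) r s"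
    using \<open>r < k * m\<close> by simp
qed simp

definition emb :: "nat \<Rightarrow> nat \<Rightarrow> fmat \<Rightarrow> fmat" where
  "emb k m Y = (\<Sum>a<k. blk m a * Y * (blk m a)\<^sup>\<dagger>)"

lemma dims_emb: "dims m m Y \<Longrightarrow> dims (k * m) (k * m) (emb k m Y)"
  unfolding emb_def by (rule dims_blk dims_intros | simp)+

lemma emb_plus: "emb k m (X + Y) = emb k m X + emb k m Y"
  by (simp add: emb_def algebra_simps sum.distrib)

lemma emb_fsmul: "emb k m (c *\<^sub>C X) = c *\<^sub>C emb k m X"
  by (simp add: emb_def fsmul_sum_right)

lemma emb_fadj: "(emb k m X)\<^sup>\<dagger> = emb k m (X\<^sup>\<dagger>)"
  by (simp add: emb_def mult.assoc)

lemma emb_fid: "emb k m (fid m) = fid (k * m)"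
  unfolding emb_def sum_blk_blk_fadj[symmetric]
  by (rule sum.cong) (auto simp: times_fid[OF dims_blk])

text \<open>The blocks have orthogonal ranges, so one summand survives. Multiplicativity of
  \<open>emb\<close> rests on this relation, and so does the recovery of \<open>Y\<close> from I
  \<otimes> \<open>Y\<close>.\<close>

lemma emb_times_blk:
  assumes "dims m m X" "a < k"
  shows "emb k m X * blk m a = blk m a * X"
proof -
  have "emb k m X * blk m a = (\<Sum>a'<k. if a' = a then blk m a' * (X * fid m) else 0)"
    unfolding emb_def sum_distrib_right
    by (rule sum.cong) (auto simp: mult.assoc blk_fadj_times_blk)
  then show ?thesis using assms by (simp add: times_fid)
qed

lemma emb_times:
  assumes "dims m m X"
  shows "emb k m X * emb k m Y = emb k m (X * Y)"
proof -
  have "emb k m X * emb k m Y = (\<Sum>a<k. emb k m X * blk m a * Y * (blk m a)\<^sup>\<dagger>)"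
    by (simp add: emb_def[of _ _ Y] sum_distrib_left mult.assoc)
  also have "\<dots> = emb k m (X * Y)"
    unfolding emb_def[of _ _ "X * Y"] by (rule sum.cong) (auto simp: emb_times_blk[OF assms] mult.assoc)
  finally show ?thesis .
qed

lemma fm_kron_one:
  assumes "Y \<in> carrier_mat m m"
  shows "fm (kron k m (1\<^sub>m k) Y) = emb k m (fm Y)"
proof (rule fmat_dims_eqI)
  show "dims (k * m) (k * m) (fm (kron k m (1\<^sub>m k) Y))" by (rule dims_fm) (simp add: kron_def)
  show "dims (k * m) (k * m) (emb k m (fm Y))" by (rule dims_emb[OF dims_fm[OF assms]])
  fix r s assume rs: "r < k * m" "s < k * m"
  then have m: "m > 0" and rk: "r div m < k" "s div m < k" by (auto intro: Nat.gr0I simp: less_mult_imp_div_less)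
  have "ent (emb k m (fm Y)) r s = (\<Sum>a<k. if a = r div m then (if s div m = a then ent (fm Y) (r mod m) (s mod m) else 0) else 0)"
    using m unfolding emb_def ent_sum mult.assoc ent_blk_times ent_times_blk_fadj by (auto intro!: sum.cong)
  then show "ent (fm (kron k m (1\<^sub>m k) Y)) r s = ent (emb k m (fm Y)) r s"
    using rs rk m assms by (auto simp: ent_fm kron_def)
qed

section \<open>Rigidity of Kraus operators\<close>

lemma ent_times_funit_times: "ent (A * funit b c * B) p q = ent A p b * ent B c q"
proof -
  obtain N where N: "dims N N A" using dims_exists by blast
  have "ent (A * funit b c * B) p q = (\<Sum>k<N. if k = b then ent A p b * ent B c q else 0)"
    unfolding mult.assoc ent_times[OF N] ent_funit_times by (rule sum.cong) auto
  then show ?thesis using dimsD[OF N, of p b] by (cases "b < N") auto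
qed

lemma sum_mult_cnj_eq_0:
  assumes "finite I" "(\<Sum>i\<in>I. z i * cnj (z i)) = 0" "i \<in> I"
  shows "z i = 0"
proof -
  have "(\<Sum>i\<in>I. z i * cnj (z i)) = of_real (\<Sum>i\<in>I. (cmod (z i))\<^sup>2)"
    by (simp only: of_real_sum complex_norm_square)
  then have "complex_of_real (\<Sum>i\<in>I. (cmod (z i))\<^sup>2) = 0" using assms(2) by (rule trans[OF sym])
  then have "(\<Sum>i\<in>I. (cmod (z i))\<^sup>2) = 0" by (rule of_real_eq_0_iff[THEN iffD1])
  then show ?thesis using assms by (simp add: sum_nonneg_eq_0_iff)
qed

text \<open>Testing \<open>eq\<close> on \<open>funit b b\<close> makes the entries off the diagonal
  vanish, since their squared moduli add up to 0. Testing on \<open>funit b c\<close> gives all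
  pairs of diagonal entries the same correlation \<open>g\<close>, so the squared moduli of the
  difference of two of them add up to g - g - g + g = 0.\<close>

lemma sum_conj_scalar_imp_scalar:
  assumes I: "finite I" and S: "\<And>i. i \<in> I \<Longrightarrow> dims m m (S i)"
    and eq: "\<And>Y. dims m m Y \<Longrightarrow> (\<Sum>i\<in>I. S i * Y * (S i)\<^sup>\<dagger>) = g *\<^sub>C Y"
    and i: "i \<in> I"
  shows "\<exists>t. S i = t *\<^sub>C fid m"
proof -
  have e: "(\<Sum>i\<in>I. ent (S i) p b * cnj (ent (S i) q c)) = (if p = b \<and> q = c then g else 0)"
    if "b < m" "c < m" for b c p q
    using arg_cong[OF eq[OF dims_funit[OF that]], of "\<lambda>A. ent A p q"] by (simp add: ent_times_funit_times)
  have off: "ent (S i) p b = 0" if "b < m" "p \<noteq> b" for p b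
    using sum_mult_cnj_eq_0[OF I _ i, of "\<lambda>i. ent (S i) p b"] e[of b b p p] that by simp
  have diag: "ent (S i) b b = ent (S i) c c" if bc: "b < m" "c < m" for b c
  proof -
    have "(\<Sum>i\<in>I. (ent (S i) b b - ent (S i) c c) * cnj (ent (S i) b b - ent (S i) c c))
      = (\<Sum>i\<in>I. ent (S i) b b * cnj (ent (S i) b b)) - (\<Sum>i\<in>I. ent (S i) b b * cnj (ent (S i) c c))
      - (\<Sum>i\<in>I. ent (S i) c c * cnj (ent (S i) b b)) + (\<Sum>i\<in>I. ent (S i) c c * cnj (ent (S i) c c))"
      unfolding sum_subtractf[symmetric] sum.distrib[symmetric] by (rule sum.cong) (auto simp: algebra_simps)
    also have "\<dots> = 0" using bc by (simp add: e)
    finally show ?thesis using sum_mult_cnj_eq_0[OF I _ i, of "\<lambda>i. ent (S i) b b - ent (S i) c c"] by simp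
  qed
  have "S i = ent (S i) 0 0 *\<^sub>C fid m"
  proof (rule fmat_dims_eqI[OF S[OF i]])
    fix p q assume pq: "p < m" "q < m"
    then show "ent (S i) p q = ent (ent (S i) 0 0 *\<^sub>C fid m) p q"
      using off[of q p] diag[of p 0] by auto
  qed (rule dims_intros dims_fid)+
  then show ?thesis ..
qed

text \<open>The last conjunct, that the \<open>W j\<close> inherit scalar products from the \<open>M i\<close>, is what keeps the
induction going.\<close>

lemma gram_schmidt_isometries:
  assumes "finite I" "\<And>i. i \<in> I \<Longrightarrow> dims n m (M i)"
    and "\<And>i j. i \<in> I \<Longrightarrow> j \<in> I \<Longrightarrow> \<exists>c. (M i)\<^sup>\<dagger> * M j = c *\<^sub>C fid m"
  shows "\<exists>W J. finite J \<and> (\<forall>i\<in>J. dims n m (W i))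
    \<and> (\<forall>i\<in>J. \<forall>j\<in>J. (W i)\<^sup>\<dagger> * W j = (if i = j then fid m else 0))
    \<and> (\<forall>i\<in>I. \<exists>g. M i = (\<Sum>j\<in>J. g j *\<^sub>C W j))
    \<and> J \<subseteq> I
    \<and> (\<forall>X. (\<forall>i\<in>I. \<exists>c. (M i)\<^sup>\<dagger> * X = c *\<^sub>C fid m) \<longrightarrow> (\<forall>j\<in>J. \<exists>c. (W j)\<^sup>\<dagger> * X = c *\<^sub>C fid m))"
  using assms
proof (induction I)
  case empty
  then show ?case by (intro exI[of _ "\<lambda>_. 0"] exI[of _ "{}"]) auto
next
  case (insert x I)
  have "\<exists>W J. finite J \<and> (\<forall>i\<in>J. dims n m (W i))
    \<and> (\<forall>i\<in>J. \<forall>j\<in>J. (W i)\<^sup>\<dagger> * W j = (if i = j then fid m else 0))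
    \<and> (\<forall>i\<in>I. \<exists>g. M i = (\<Sum>j\<in>J. g j *\<^sub>C W j))
    \<and> J \<subseteq> I
    \<and> (\<forall>X. (\<forall>i\<in>I. \<exists>c. (M i)\<^sup>\<dagger> * X = c *\<^sub>C fid m) \<longrightarrow> (\<forall>j\<in>J. \<exists>c. (W j)\<^sup>\<dagger> * X = c *\<^sub>C fid m))"
    by (rule insert.IH) (use insert.prems in auto)
  then obtain W J where J: "finite J" and 1: "\<forall>i\<in>J. dims n m (W i)"
      "\<forall>i\<in>J. \<forall>j\<in>J. (W i)\<^sup>\<dagger> * W j = (if i = j then fid m else 0)"
      "\<forall>i\<in>I. \<exists>g. M i = (\<Sum>j\<in>J. g j *\<^sub>C W j)"
    and JI: "J \<subseteq> I"
    and 2: "\<forall>X. (\<forall>i\<in>I. \<exists>c. (M i)\<^sup>\<dagger> * X = c *\<^sub>C fid m) \<longrightarrow> (\<forall>j\<in>J. \<exists>c. (W j)\<^sup>\<dagger> * X = c *\<^sub>C fid m)"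
    by (elim exE conjE) (rule that)
  note dW = 1(1)[rule_format] and WW = 1(2)[rule_format] and MW = 1(3)[rule_format]
  have WX: "\<exists>c. (W j)\<^sup>\<dagger> * X = c *\<^sub>C fid m" if "\<forall>i\<in>I. \<exists>c. (M i)\<^sup>\<dagger> * X = c *\<^sub>C fid m" "j \<in> J" for X j
    using 2 that by blast
  have "\<forall>j\<in>J. \<exists>c. (W j)\<^sup>\<dagger> * M x = c *\<^sub>C fid m"
    using WX[of "M x"] insert.prems(2) by blast
  then obtain w where w: "\<And>j. j \<in> J \<Longrightarrow> (W j)\<^sup>\<dagger> * M x = w j *\<^sub>C fid m" by metis
  define N where "N = M x - (\<Sum>j\<in>J. w j *\<^sub>C W j)"
  have dN: "dims n m N" unfolding N_def
    by (intro dims_minus dims_sum dims_fsmul dW insert.prems(1)) auto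
  have Mx: "M x = N + (\<Sum>j\<in>J. w j *\<^sub>C W j)" by (simp add: N_def)
  have WN: "(W j)\<^sup>\<dagger> * N = 0" if j: "j \<in> J" for j
  proof -
    have "(W j)\<^sup>\<dagger> * (\<Sum>i\<in>J. w i *\<^sub>C W i) = (\<Sum>i\<in>J. if i = j then w i *\<^sub>C fid m else 0)"
      unfolding sum_distrib_left by (rule sum.cong) (auto simp: WW j)
    then show ?thesis using j J by (simp add: N_def right_diff_distrib w)
  qed
  have NW: "N\<^sup>\<dagger> * W j = 0" if j: "j \<in> J" for j
    using arg_cong[OF WN[OF j], of fadj] by simp
  obtain c where c: "(M x)\<^sup>\<dagger> * M x = c *\<^sub>C fid m" using insert.prems(2)[of x x] by auto
  \<comment> \<open>\<open>N\<close> is orthogonal to the \<open>W j\<close>, so its second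
    occurrence may be replaced by \<open>M x\<close>, whose products with itself and with the
    \<open>W j\<close> are scalar. Unless it is zero, \<open>N\<close> is therefore an isometry up
    to scaling.\<close>
  have "N\<^sup>\<dagger> * N = N\<^sup>\<dagger> * M x"
    by (subst Mx) (simp add: distrib_left sum_distrib_left NW)
  also have "\<dots> = (c - (\<Sum>j\<in>J. cnj (w j) * w j)) *\<^sub>C fid m"
    by (simp add: N_def left_diff_distrib c sum_distrib_right w fsmul_diff_left fsmul_sum_left)
  finally obtain \<nu> where \<nu>: "N\<^sup>\<dagger> * N = \<nu> *\<^sub>C fid m" by blast
  show ?case
  proof (cases "N = 0")
    case True
    then have "\<exists>g. M x = (\<Sum>j\<in>J. g j *\<^sub>C W j)" using Mx by auto
    then show ?thesis using J dW WW MW JI WX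
      by (intro exI[of _ W] exI[of _ J] conjI ballI allI impI) blast+
  next
    case False
    \<comment> \<open>Allows \<nu> to be read off from entry (0,0) of
      \<open>\<nu> *\<^sub>C fid m\<close>.\<close>
    have m: "m > 0"
    proof (rule ccontr)
      assume "\<not> m > 0"
      then have "N = 0" using dimsD[OF dN] by (intro fmat_eqI) auto
      then show False using False by simp
    qed
    have "\<nu> = ent (N\<^sup>\<dagger> * N) 0 0" using m by (simp add: \<nu>)
    also have "\<dots> = (\<Sum>k<n. cnj (ent N k 0) * ent N k 0)" by (simp add: ent_times'[OF dN])
    also have "\<dots> = of_real (\<Sum>k<n. (cmod (ent N k 0))\<^sup>2)"
      by (simp only: of_real_sum complex_norm_square mult.commute)
    finally obtain \<rho> where \<rho>: "\<nu> = of_real \<rho>" "\<rho> \<ge> 0" by (metis sum_nonneg zero_le_power2)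
    have "\<nu> \<noteq> 0"
    proof
      assume "\<nu> = 0"
      then have "N\<^sup>\<dagger> * N = 0" using \<nu> by simp
      then have "N\<^sup>\<dagger> = 0" using sum_times_fadj_eq_0[of "{()}" "\<lambda>_. N\<^sup>\<dagger>"] by simp
      then have "N = 0" using fadj_fadj[of N] by simp
      then show False using False by simp
    qed
    then have rpos: "\<rho> > 0" using \<rho> by (cases "\<rho> = 0") auto
    define s where "s = complex_of_real (sqrt \<rho>)"
    have s: "s * s = \<nu>" "cnj s = s" "s \<noteq> 0"
      using rpos by (simp_all add: s_def \<rho> flip: of_real_mult)
    \<comment> \<open>The new isometry takes the index \<open>x\<close> of the operator it comes
      from; the conjunct \<open>J \<subseteq> I\<close> guarantees that this index is free.\<close>
    define W' where "W' = W(x := (1/s) *\<^sub>C N)"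
    have xJ: "x \<notin> J" using JI insert.hyps by blast
    have W'J: "W' j = W j" if "j \<in> J" for j using that xJ by (auto simp: W'_def)
    have W'x: "W' x = (1/s) *\<^sub>C N" by (simp add: W'_def)
    have sumJ: "(\<Sum>j\<in>insert x J. g j *\<^sub>C W' j) = (g x / s) *\<^sub>C N + (\<Sum>j\<in>J. g j *\<^sub>C W j)" for g
      using J xJ by (simp add: W'x W'J)
    have "M i = (\<Sum>j\<in>insert x J. (g(x := 0)) j *\<^sub>C W' j)" if "M i = (\<Sum>j\<in>J. g j *\<^sub>C W j)" for i g
      unfolding sumJ using that xJ by (auto intro!: sum.cong)
    moreover have "M x = (\<Sum>j\<in>insert x J. (w(x := s)) j *\<^sub>C W' j)"
      unfolding sumJ using xJ s by (subst Mx) (auto intro!: sum.cong)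
    ultimately have 1: "\<exists>g. M i = (\<Sum>j\<in>insert x J. g j *\<^sub>C W' j)" if "i \<in> insert x I" for i
      using that MW by blast
    have 2: "(W' i)\<^sup>\<dagger> * W' j = (if i = j then fid m else 0)" if "i \<in> insert x J" "j \<in> insert x J" for i j
      using that xJ s by (auto simp: W'x W'J WW WN NW \<nu>)
    have 3: "\<exists>c. (W' j)\<^sup>\<dagger> * X = c *\<^sub>C fid m"
      if X: "\<forall>i\<in>insert x I. \<exists>c. (M i)\<^sup>\<dagger> * X = c *\<^sub>C fid m" and j: "j \<in> insert x J" for X j
    proof -
      have "\<forall>j\<in>J. \<exists>c. (W j)\<^sup>\<dagger> * X = c *\<^sub>C fid m" using WX X by blast
      then obtain h where h: "\<And>j. j \<in> J \<Longrightarrow> (W j)\<^sup>\<dagger> * X = h j *\<^sub>C fid m" by metis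
      obtain c where c: "(M x)\<^sup>\<dagger> * X = c *\<^sub>C fid m" using X by blast
      \<comment> \<open>\<open>N\<close> is a combination of \<open>M x\<close> and the
        \<open>W j\<close> with scalar coefficients, and the products of these with \<open>X\<close>
        are scalar.\<close>
      have "N\<^sup>\<dagger> * X = (c - (\<Sum>j\<in>J. cnj (w j) * h j)) *\<^sub>C fid m"
        by (simp add: N_def left_diff_distrib c sum_distrib_right h fsmul_diff_left fsmul_sum_left)
      then have "(W' x)\<^sup>\<dagger> * X = (cnj (1/s) * (c - (\<Sum>j\<in>J. cnj (w j) * h j))) *\<^sub>C fid m"
        by (simp add: W'x)
      then show ?thesis using j h W'J by auto
    qed
    have 4: "dims n m (W' j)" if "j \<in> insert x J" for j
      using that dW dN by (auto simp: W'x W'J intro: dims_fsmul)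
    show ?thesis
    proof (intro exI[of _ W'] exI[of _ "insert x J"] conjI ballI allI impI)
      show "finite (insert x J)" using J by simp
      show "insert x J \<subseteq> insert x I" using JI by blast
    qed (fact 1 2 3 4)+
  qed
qed

section \<open>The equivalence\<close>

lemma quantum_channel_zero:
  assumes "quantum_channel n E" "A \<in> carrier_mat n n" "fm A = 0"
  shows "E A = 0\<^sub>m n n"
proof (rule fm_inject)
  show "E A \<in> carrier_mat n n" using assms by (simp add: quantum_channel_def lin_map_def)
  show "fm (E A) = fm (0\<^sub>m n n)"
    by (rule quantum_channel_kraus[OF assms(1)]) (simp add: assms fm_zero)
qed simp

section \<open>The code space and the algebra of the subsystem\<close>

locale subsystem =
  fixes n dA dB :: nat and V :: "complex mat"
  assumes isom: "isometry n (dA * dB) V"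
begin

abbreviation v :: fmat where "v \<equiv> fm V"

text \<open>Parametrises the algebra of B by its matrices of size \<open>dB\<close>, so that a
  homomorphism on the algebra can be handled as a map on such matrices.\<close>

definition el :: "fmat \<Rightarrow> complex mat" where
  "el Y = mf n n (v * emb dA dB Y * v\<^sup>\<dagger>)"

lemma V_carrier: "V \<in> carrier_mat n (dA * dB)"
  using isom by (simp add: isometry_def)

lemma dims_v: "dims n (dA * dB) v"
  by (rule dims_fm[OF V_carrier])

lemma v_isometry: "v\<^sup>\<dagger> * v = fid (dA * dB)"
  using isom fm_times[OF adj_carrier[OF V_carrier] V_carrier] by (simp add: isometry_def fm_adj fm_one)

lemma dims_conj_v: "dims (dA * dB) (dA * dB) X \<Longrightarrow> dims n n (v * X * v\<^sup>\<dagger>)"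
  by (rule dims_v dims_intros | assumption)+

lemma el_carrier [simp]: "el Y \<in> carrier_mat n n"
  by (simp add: el_def)

lemma fm_el: "dims dB dB Y \<Longrightarrow> fm (el Y) = v * emb dA dB Y * v\<^sup>\<dagger>"
  unfolding el_def by (intro fm_mf dims_conj_v dims_emb)

lemma fm_conj_V:
  assumes "X \<in> carrier_mat (dA * dB) (dA * dB)"
  shows "fm (V * X * adj V) = v * fm X * v\<^sup>\<dagger>"
  using fm_times[of "V * X" n "dA * dB" "adj V" n] fm_times[OF V_carrier assms] V_carrier assms
  by (simp add: fm_adj adj_carrier)

lemma alg_B_eq: "alg_B dA dB V = el ` {Y. dims dB dB Y}"
proof -
  have eq: "V * kron dA dB (1\<^sub>m dA) Y * adj V = el (fm Y)" if "Y \<in> carrier_mat dB dB" for Y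
  proof (rule fm_inject)
    have k: "kron dA dB (1\<^sub>m dA) Y \<in> carrier_mat (dA * dB) (dA * dB)" by (simp add: kron_def)
    show "V * kron dA dB (1\<^sub>m dA) Y * adj V \<in> carrier_mat n n"
      using V_carrier k adj_carrier[OF V_carrier] by (metis mult_carrier_mat)
    show "fm (V * kron dA dB (1\<^sub>m dA) Y * adj V) = fm (el (fm Y))"
      by (simp add: fm_conj_V[OF k] fm_kron_one[OF that] fm_el[OF dims_fm[OF that]])
  qed simp
  show ?thesis
  proof
    show "alg_B dA dB V \<subseteq> el ` {Y. dims dB dB Y}"
      unfolding alg_B_def using eq dims_fm by blast
    show "el ` {Y. dims dB dB Y} \<subseteq> alg_B dA dB V"
    proof
      fix x assume "x \<in> el ` {Y. dims dB dB Y}"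
      then obtain Y where "dims dB dB Y" "x = el Y" by blast
      then have "x = V * kron dA dB (1\<^sub>m dA) (mf dB dB Y) * adj V" by (simp add: eq fm_mf)
      then show "x \<in> alg_B dA dB V" unfolding alg_B_def using mf_carrier by blast
    qed
  qed
qed

lemma proj_C_eq: "proj_C V = el (fid dB)"
proof (rule fm_inject)
  show "proj_C V \<in> carrier_mat n n"
    using V_carrier adj_carrier[OF V_carrier] by (simp add: proj_C_def)
  show "fm (proj_C V) = fm (el (fid dB))"
    using fm_times[OF V_carrier adj_carrier[OF V_carrier]]
    by (simp add: proj_C_def fm_el emb_fid times_fid[OF dims_v] fm_adj)
qed simp

lemma el_plus:
  assumes "dims dB dB X" "dims dB dB Y"
  shows "el X + el Y = el (X + Y)"
  by (rule fm_inject[of _ n n])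
     (auto simp: fm_plus[of _ n n] fm_el assms dims_plus emb_plus algebra_simps)

lemma el_smult:
  assumes "dims dB dB X"
  shows "c \<cdot>\<^sub>m el X = el (c *\<^sub>C X)"
  by (rule fm_inject[of _ n n])
     (auto simp: fm_smult fm_el assms dims_fsmul emb_fsmul)

lemma el_times:
  assumes "dims dB dB X" "dims dB dB Y"
  shows "el X * el Y = el (X * Y)"
proof (rule fm_inject[of _ n n])
  have "v * emb dA dB X * v\<^sup>\<dagger> * (v * emb dA dB Y * v\<^sup>\<dagger>)
      = v * emb dA dB X * (v\<^sup>\<dagger> * v) * emb dA dB Y * v\<^sup>\<dagger>" by (simp add: mult.assoc)
  also have "\<dots> = v * emb dA dB (X * Y) * v\<^sup>\<dagger>"
    unfolding v_isometry mult.assoc[of v "emb dA dB X"] times_fid[OF dims_emb[OF assms(1)]]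
    by (simp add: emb_times[OF assms(1), symmetric] mult.assoc)
  finally show "fm (el X * el Y) = fm (el (X * Y))"
    by (simp add: fm_times[of _ n n _ n] fm_el assms dims_times[OF assms])
qed (auto intro: mult_carrier_mat[of _ n n])

lemma el_adj:
  assumes "dims dB dB X"
  shows "adj (el X) = el (X\<^sup>\<dagger>)"
  by (rule fm_inject[of _ n n])
     (auto simp: fm_adj fm_el assms dims_fadj emb_fadj[symmetric] mult.assoc intro: adj_carrier)

text \<open>Both sides depend on the state only through its compression X =
  \<open>v\<^sup>\<dagger> * fm \<rho> * v\<close>. In this form the recovery condition can be
  checked on, and applied to, operators X on A \<otimes> B.\<close>

lemma correctable_eq_iff:
  assumes "quantum_channel n R" "quantum_channel n E" "\<rho> \<in> carrier_mat n n"
  shows "R (E (proj_C V * \<rho> * proj_C V)) = V * tensor_id dA dB F (adj V * \<rho> * V) * adj V \<longleftrightarrow>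
    fm (R (E (mf n n (v * (v\<^sup>\<dagger> * fm \<rho> * v) * v\<^sup>\<dagger>))))
      = v * fm (tensor_id dA dB F (mf (dA * dB) (dA * dB) (v\<^sup>\<dagger> * fm \<rho> * v))) * v\<^sup>\<dagger>"
proof -
  have aV: "adj V \<in> carrier_mat (dA * dB) n" by (rule adj_carrier[OF V_carrier])
  have P: "proj_C V \<in> carrier_mat n n" by (simp add: proj_C_eq)
  have fP: "fm (proj_C V) = v * v\<^sup>\<dagger>" by (simp add: proj_C_eq fm_el emb_fid times_fid[OF dims_v])
  have dX: "dims (dA * dB) (dA * dB) (v\<^sup>\<dagger> * fm \<rho> * v)"
    by (rule dims_v dims_fm[OF assms(3)] dims_intros)+
  have 1: "proj_C V * \<rho> * proj_C V = mf n n (v * (v\<^sup>\<dagger> * fm \<rho> * v) * v\<^sup>\<dagger>)"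
  proof (rule fm_inject[of _ n n])
    show "fm (proj_C V * \<rho> * proj_C V) = fm (mf n n (v * (v\<^sup>\<dagger> * fm \<rho> * v) * v\<^sup>\<dagger>))"
      unfolding fm_mf[OF dims_conj_v[OF dX]]
      using P assms(3) by (simp add: fm_times[of _ n n _ n] fP mult.assoc)
    show "proj_C V * \<rho> * proj_C V \<in> carrier_mat n n"
      by (rule mult_carrier_mat[OF mult_carrier_mat[OF P assms(3)] P])
  qed simp
  have 2: "adj V * \<rho> * V = mf (dA * dB) (dA * dB) (v\<^sup>\<dagger> * fm \<rho> * v)"
  proof (rule fm_inject[of _ "dA * dB" "dA * dB"])
    show "fm (adj V * \<rho> * V) = fm (mf (dA * dB) (dA * dB) (v\<^sup>\<dagger> * fm \<rho> * v))"
      unfolding fm_mf[OF dX] using fm_times[of "adj V * \<rho>" "dA * dB" n V "dA * dB"] fm_times[OF aV assms(3)]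
        aV assms(3) V_carrier by (simp add: fm_adj)
    show "adj V * \<rho> * V \<in> carrier_mat (dA * dB) (dA * dB)"
      by (rule mult_carrier_mat[OF mult_carrier_mat[OF aV assms(3)] V_carrier])
  qed simp
  have 3: "tensor_id dA dB F M \<in> carrier_mat (dA * dB) (dA * dB)" for M by (simp add: tensor_id_def)
  have 4: "R (E (mf n n Z)) \<in> carrier_mat n n" for Z
    using assms by (simp add: quantum_channel_def lin_map_def)
  show ?thesis unfolding 1 2 fm_conj_V[OF 3, symmetric]
    using fm_inject[OF 4] mult_carrier_mat[OF mult_carrier_mat[OF V_carrier 3] aV] by metis
qed

section \<open>From the homomorphism to a recovery channel\<close>

lemma correctable_if_star_hom:
  assumes E: "quantum_channel n E" and pos: "dA > 0" "dB > 0"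
    and hom: "star_hom (alg_B dA dB V) n \<pi>"
    and Epi: "\<And>\<rho>. \<rho> \<in> alg_B dA dB V \<Longrightarrow> E \<rho> = \<pi> \<rho> * E (proj_C V) \<and> E \<rho> = E (proj_C V) * \<pi> \<rho>"
  shows "correctable_subsystem n dA dB V E"
proof -
  define d where "d = dA * dB"
  note dv = dims_v[folded d_def] and vv = v_isometry[folded d_def]
  obtain r :: nat and K where K: "kraus n {..<r} K"
    and EK: "\<And>A. A \<in> carrier_mat n n \<Longrightarrow> fm (E A) = (\<Sum>k<r. K k * fm A * (K k)\<^sup>\<dagger>)"
    using quantum_channel_kraus[OF E] by blast
  have dK: "dims n n (K k)" if "k < r" for k using K that by (simp add: kraus_def)
  have KK: "(\<Sum>k<r. (K k)\<^sup>\<dagger> * K k) = fid n" using K by (simp add: kraus_def)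
  have elB: "el Y \<in> alg_B dA dB V" if "dims dB dB Y" for Y using that by (auto simp: alg_B_eq)
  have Ec: "E A \<in> carrier_mat n n" if "A \<in> carrier_mat n n" for A
    using E that by (simp add: quantum_channel_def lin_map_def)
  \<comment> \<open>\<pi> transported to matrices of size \<open>dB\<close>, where it can be
    evaluated at matrix units.\<close>
  define p where "p Y = fm (\<pi> (el Y))" for Y
  have pc: "\<pi> (el Y) \<in> carrier_mat n n" if "dims dB dB Y" for Y
    using hom elB[OF that] by (simp add: star_hom_def)
  have dp: "dims n n (p Y)" if "dims dB dB Y" for Y unfolding p_def by (rule dims_fm[OF pc[OF that]])
  have p_plus: "p (X + Y) = p X + p Y" if "dims dB dB X" "dims dB dB Y" for X Y
    using hom elB that pc by (simp add: p_def star_hom_def el_plus[symmetric] fm_plus[of _ n n])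
  have p_times: "p (X * Y) = p X * p Y" if "dims dB dB X" "dims dB dB Y" for X Y
    using hom elB that pc by (simp add: p_def star_hom_def el_times[symmetric] fm_times[of _ n n _ n])
  have p_adj: "p (X\<^sup>\<dagger>) = (p X)\<^sup>\<dagger>" if "dims dB dB X" for X
    using hom elB that by (simp add: p_def star_hom_def el_adj[symmetric] fm_adj)
  have p_smul: "p (c *\<^sub>C X) = c *\<^sub>C p X" if "dims dB dB X" for c X
    using hom elB that by (simp add: p_def star_hom_def el_smult[symmetric] fm_smult)
  have p_zero: "p 0 = 0" using p_smul[of 0 0] by simp
  have p_sum: "p (sum f J) = (\<Sum>x\<in>J. p (f x))" if "\<And>x. x \<in> J \<Longrightarrow> dims dB dB (f x)" for f and J :: "nat set"
    using that by (induction J rule: infinite_finite_induct) (auto simp: p_zero p_plus dims_sum)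
  define \<sigma> where "\<sigma> = fm (E (el (fid dB)))"
  have Phi: "fm (E (el Y)) = (\<Sum>k<r. K k * v * emb dA dB Y * v\<^sup>\<dagger> * (K k)\<^sup>\<dagger>)" if "dims dB dB Y" for Y
    by (simp add: EK fm_el[OF that] mult.assoc)
  have sig: "\<sigma> = (\<Sum>k<r. K k * v * v\<^sup>\<dagger> * (K k)\<^sup>\<dagger>)"
    unfolding \<sigma>_def by (simp add: EK fm_el emb_fid times_fid[OF dims_v] mult.assoc)
  have Ep: "fm (E (el Y)) = p Y * \<sigma>" "fm (E (el Y)) = \<sigma> * p Y" if Y: "dims dB dB Y" for Y
    using Epi[OF elB[OF Y]] pc[OF Y] Ec[of "el (fid dB)"]
    by (metis p_def \<sigma>_def proj_C_eq fm_times el_carrier)+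
  have inter: "K k * v * emb dA dB Y = p Y * (K k * v)" if Y: "dims dB dB Y" and k: "k < r" for Y k
  proof -
    define D where "D k = K k * v * emb dA dB Y - p Y * (K k * v)" for k
    have dY: "dims dB dB (Y\<^sup>\<dagger>)" by (rule dims_fadj[OF Y])
    have dYY: "dims dB dB (Y * Y\<^sup>\<dagger>)" by (rule dims_times[OF Y dY])
    \<comment> \<open>Expansion into four terms, each rewritten by \<open>Ep(1)\<close>: the first
      then cancels against the third and the second against the fourth.\<close>
    have "(\<Sum>k<r. D k * (D k)\<^sup>\<dagger>) = (\<Sum>k<r. K k * v * emb dA dB (Y * Y\<^sup>\<dagger>) * v\<^sup>\<dagger> * (K k)\<^sup>\<dagger>)
        - (\<Sum>k<r. K k * v * emb dA dB Y * v\<^sup>\<dagger> * (K k)\<^sup>\<dagger>) * (p Y)\<^sup>\<dagger>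
        - p Y * (\<Sum>k<r. K k * v * emb dA dB (Y\<^sup>\<dagger>) * v\<^sup>\<dagger> * (K k)\<^sup>\<dagger>)
        + p Y * (\<Sum>k<r. K k * v * v\<^sup>\<dagger> * (K k)\<^sup>\<dagger>) * (p Y)\<^sup>\<dagger>"
      unfolding D_def emb_times[OF Y, symmetric] emb_fadj[symmetric] sum_distrib_left sum_distrib_right
        sum_subtractf[symmetric] sum.distrib[symmetric]
      by (rule sum.cong) (simp_all add: algebra_simps)
    also have "\<dots> = p Y * (p Y)\<^sup>\<dagger> * \<sigma> - p Y * \<sigma> * (p Y)\<^sup>\<dagger> - p Y * ((p Y)\<^sup>\<dagger> * \<sigma>) + p Y * \<sigma> * (p Y)\<^sup>\<dagger>"
      unfolding Phi[OF dYY, symmetric] Phi[OF Y, symmetric] Phi[OF dY, symmetric] sig[symmetric]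
        Ep(1)[OF dYY] Ep(1)[OF Y] Ep(1)[OF dY] p_times[OF Y dY] p_adj[OF Y] ..
    also have "\<dots> = 0" by (simp add: mult.assoc)
    finally have "D k = 0" using k by (intro sum_times_fadj_eq_0[of "{..<r}" D]) auto
    then show ?thesis by (simp add: D_def)
  qed
  \<comment> \<open>The image of P_C under \<pi>, a projection. By \<open>QK\<close> its range
    contains everything the channel produces from the code.\<close>
  define Q where "Q = p (fid dB)"
  have dQ: "dims n n Q" unfolding Q_def by (rule dp) simp
  have Q: "Q\<^sup>\<dagger> = Q" "Q * Q = Q"
    using p_adj[of "fid dB"] p_times[of "fid dB" "fid dB"] by (simp_all add: Q_def fid_times[of _ dB])
  have QK: "Q * (K k * v) = K k * v" if "k < r" for k
    using inter[of "fid dB" k] that by (simp add: Q_def emb_fid mult.assoc times_fid[OF dims_v])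
  have dB_le: "dB \<le> d" using pos by (simp add: d_def)
  \<comment> \<open>Makes row 0 available for the operators \<open>T\<close> below.\<close>
  have n: "n > 0"
  proof (rule ccontr)
    assume "\<not> n > 0"
    then have "v\<^sup>\<dagger> * v = 0" using dimsD[OF dv] by (intro fmat_eqI) (simp add: ent_times'[OF dv])
    then have "ent (fid d) 0 0 = 0" by (simp only: vv ent_zero)
    then show False using pos by (simp add: d_def)
  qed
  have de: "dims dB dB (funit 0 b)" "dims dB dB (funit b 0)" if "b < dB" for b
    using that pos by (auto intro: dims_funit)
  \<comment> \<open>Kraus operators of the adjoint of \<open>p\<close>, followed by placing B next
    to the vector |0> of A: column \<open>b\<close> of \<open>v\<close> is the image of |0>
    \<otimes> |b>, and summing over \<open>m\<close> takes the trace. Row 0 in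
    \<open>funit 0 b\<close> is a reference that disappears through
    \<open>p (funit b' 0) * p (funit 0 b) = p (funit b' b)\<close>.\<close>
  define S where "S m = (\<Sum>b<dB. v * funit b m * p (funit 0 b))" for m
  \<comment> \<open>Completes the family to a trace-preserving one by sending the complement of
    \<open>Q\<close> to a fixed vector.\<close>
  define T where "T m = funit 0 m * (fid n - Q)" for m
  define L where "L = case_sum S T"
  define I where "I = {..<n} <+> {..<n}"
  have L_sum: "(\<Sum>x\<in>I. h (L x)) = (\<Sum>m<n. h (S m)) + (\<Sum>m<n. h (T m))" for h :: "fmat \<Rightarrow> fmat"
    by (simp add: I_def sum.Plus L_def)
  have dS: "dims n n (S m)" if "m < n" for m
    unfolding S_def
  proof (rule dims_sum)
    fix b assume "b \<in> {..<dB}"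
    then show "dims n n (v * funit b m * p (funit 0 b))"
      using dB_le that by (intro dims_times[OF dims_times[OF dv dims_funit] dp] de) auto
  qed
  have dT: "dims n n (T m)" if "m < n" for m
    unfolding T_def using n that dQ by (intro dims_times[of n n] dims_funit dims_minus) auto
  \<comment> \<open>Orthonormality of the columns of \<open>v\<close> leaves one sum over
    \<open>b\<close>; the sum over \<open>m\<close> inserts the identity, and what remains is the
    sum of the \<open>p (funit b b)\<close>.\<close>
  have SS: "(\<Sum>m<n. (S m)\<^sup>\<dagger> * S m) = Q"
  proof -
    have "(S m)\<^sup>\<dagger> * S m = (\<Sum>b<dB. p (funit b 0) * funit m m * p (funit 0 b))" if "m < n" for m
    proof -
      have "(S m)\<^sup>\<dagger> * S m = (\<Sum>b<dB. \<Sum>b'<dB. (p (funit 0 b))\<^sup>\<dagger> * (funit m b * ((v\<^sup>\<dagger> * v) * funit b' m)) * p (funit 0 b'))"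
        by (simp add: S_def sum_product mult.assoc)
      also have "\<dots> = (\<Sum>b<dB. \<Sum>b'<dB. if b' = b then p (funit b 0) * funit m m * p (funit 0 b) else 0)"
        unfolding vv funit_times_times_funit
        using dB_le by (intro sum.cong refl) (auto simp: p_adj[OF de(1), symmetric])
      finally show ?thesis by simp
    qed
    then have "(\<Sum>m<n. (S m)\<^sup>\<dagger> * S m) = (\<Sum>m<n. \<Sum>b<dB. p (funit b 0) * funit m m * p (funit 0 b))"
      by simp
    also have "\<dots> = (\<Sum>b<dB. p (funit b 0) * fid n * p (funit 0 b))"
      unfolding fid_eq_sum sum_distrib_left sum_distrib_right by (rule sum.swap)
    also have "\<dots> = (\<Sum>b<dB. p (funit b b))"
    proof (rule sum.cong[OF refl])
      fix b assume "b \<in> {..<dB}"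
      then have b: "b < dB" by simp
      show "p (funit b 0) * fid n * p (funit 0 b) = p (funit b b)"
        using p_times[OF de(2)[OF b] de(1)[OF b]] by (simp add: times_fid[OF dp[OF de(2)[OF b]]])
    qed
    also have "\<dots> = Q" unfolding Q_def fid_eq_sum by (subst p_sum) (auto intro: dims_funit)
    finally show ?thesis .
  qed
  have TT: "(\<Sum>m<n. (T m)\<^sup>\<dagger> * T m) = fid n - Q"
  proof -
    have "(T m)\<^sup>\<dagger> * T m = (fid n - Q) * funit m m * (fid n - Q)" for m
    proof -
      have "(T m)\<^sup>\<dagger> * T m = (fid n - Q) * (funit m 0 * funit 0 m) * (fid n - Q)"
        unfolding T_def fadj_times fadj_minus Q(1) fadj_fid fadj_funit by (simp only: mult.assoc)
      then show ?thesis by simp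
    qed
    then have "(\<Sum>m<n. (T m)\<^sup>\<dagger> * T m) = (fid n - Q) * fid n * (fid n - Q)"
      by (simp add: fid_eq_sum[of n] sum_distrib_left sum_distrib_right)
    also have "\<dots> = fid n - Q"
      using dQ by (simp add: algebra_simps fid_times[of n n] times_fid[of n n] Q)
    finally show ?thesis .
  qed
  have krL: "kraus n I L"
    unfolding kraus_def
  proof (intro conjI ballI)
    show "finite I" by (simp add: I_def)
    show "dims n n (L x)" if "x \<in> I" for x using that dS dT by (auto simp: I_def L_def)
    show "(\<Sum>x\<in>I. (L x)\<^sup>\<dagger> * L x) = fid n"
      using L_sum[of "\<lambda>A. A\<^sup>\<dagger> * A"] SS TT by simp
  qed
  define R where "R A = mf n n (\<Sum>x\<in>I. L x * fm A * (L x)\<^sup>\<dagger>)" for A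
  have Rc: "quantum_channel n R" unfolding R_def by (rule kraus_quantum_channel[OF krL])
  \<comment> \<open>The A-part is reset to |0>, in agreement with the vector used in
    \<open>S\<close>.\<close>
  have krF: "kraus dA {..<dA} (\<lambda>a. funit 0 a)"
    using pos by (auto simp: kraus_def fid_eq_sum intro: dims_funit)
  define F where "F A = mf dA dA (\<Sum>a<dA. funit 0 a * fm A * (funit 0 a)\<^sup>\<dagger>)" for A
  have Fc: "quantum_channel dA F" unfolding F_def by (rule kraus_quantum_channel[OF krF])
  have main: "fm (R (E (mf n n (v * X * v\<^sup>\<dagger>)))) = v * fm (tensor_id dA dB F (mf d d X)) * v\<^sup>\<dagger>"
    if X: "dims d d X" for X
  proof -
    \<comment> \<open>The entries of the partial trace of \<open>X\<close> over A.\<close>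
    define c where "c b b' = (\<Sum>a<dA. ent X (a * dB + b) (a * dB + b'))" for b b'
    define Z where "Z = (\<Sum>k<r. K k * v * X * (K k * v)\<^sup>\<dagger>)"
    have dEm: "dims d d (emb dA dB Y)" if "dims dB dB Y" for Y unfolding d_def by (rule dims_emb[OF that])
    have Ez: "fm (E (mf n n (v * X * v\<^sup>\<dagger>))) = Z"
      unfolding EK[OF mf_carrier] fm_mf[OF dims_conj_v[OF X[unfolded d_def]]] Z_def by (simp add: mult.assoc)
    have dZ: "dims n n Z" unfolding Ez[symmetric] by (intro dims_fm Ec) simp
    have dR: "dims n n (\<Sum>x\<in>I. L x * Z * (L x)\<^sup>\<dagger>)"
      using krL dZ unfolding kraus_def by (intro dims_sum dims_times[of n n] dims_fadj) auto
    have QZ: "(fid n - Q) * Z = 0"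
    proof -
      have "(fid n - Q) * (K k * v) = 0" if "k < r" for k
        using QK[OF that] fid_times[OF dims_times[OF dK[OF that] dv]] by (simp add: left_diff_distrib)
      then show ?thesis unfolding Z_def sum_distrib_left mult.assoc[symmetric]
        by (intro sum.neutral) (simp add: mult.assoc)
    qed
    \<comment> \<open>The intertwining relation moves both factors \<open>p\<close> inside, next to
      \<open>X\<close>. Trace preservation and the isometry then remove the channel and
      \<open>v\<close>, and cyclicity leaves the trace of (I \<otimes> |b'><b|) X, which is computed
      slice by slice.\<close>
    have tr: "ftr n (p (funit 0 b) * Z * (p (funit 0 b'))\<^sup>\<dagger>) = c b b'" if b: "b < dB" "b' < dB" for b b'
    proof -
      define W where "W = emb dA dB (funit 0 b) * X * (emb dA dB (funit 0 b'))\<^sup>\<dagger>"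
      have dW: "dims d d W" unfolding W_def by (rule X dEm de b dims_intros)+
      have "p (funit 0 b) * Z * (p (funit 0 b'))\<^sup>\<dagger> = (\<Sum>k<r. (p (funit 0 b) * (K k * v)) * X * (p (funit 0 b') * (K k * v))\<^sup>\<dagger>)"
        by (simp add: Z_def sum_distrib_left sum_distrib_right mult.assoc)
      also have "\<dots> = (\<Sum>k<r. (K k * v * W) * (K k * v)\<^sup>\<dagger>)"
        by (rule sum.cong) (auto simp: inter[OF de(1), symmetric] b W_def mult.assoc)
      finally have "ftr n (p (funit 0 b) * Z * (p (funit 0 b'))\<^sup>\<dagger>) = (\<Sum>k<r. ftr n ((K k * v * W) * (K k * v)\<^sup>\<dagger>))"
        by (simp only: ftr_sum)
      also have "\<dots> = (\<Sum>k<r. ftr d ((K k * v)\<^sup>\<dagger> * (K k * v * W)))"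
        by (intro sum.cong refl ftr_cyclic) (rule dv dW dK dims_intros | simp)+
      also have "\<dots> = ftr d (v\<^sup>\<dagger> * ((\<Sum>k<r. (K k)\<^sup>\<dagger> * K k) * v) * W)"
        unfolding ftr_sum[symmetric] by (simp add: sum_distrib_left sum_distrib_right mult.assoc)
      also have "\<dots> = ftr d W" by (simp add: KK fid_times[OF dv] vv fid_times[OF dW])
      also have "\<dots> = ftr d ((emb dA dB (funit 0 b'))\<^sup>\<dagger> * (emb dA dB (funit 0 b) * X))"
        unfolding W_def by (rule ftr_cyclic) (rule X dEm de b dims_intros)+
      also have "(emb dA dB (funit 0 b'))\<^sup>\<dagger> * (emb dA dB (funit 0 b) * X) = emb dA dB (funit b' b) * X"
        using emb_times[OF de(2)[OF b(2)], of dA "funit 0 b"] by (simp add: emb_fadj mult.assoc[symmetric])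
      also have "ftr d \<dots> = (\<Sum>a<dA. ftr d (blk dB a * (funit b' b * ((blk dB a)\<^sup>\<dagger> * X))))"
        by (simp add: emb_def sum_distrib_right ftr_sum mult.assoc)
      also have "\<dots> = (\<Sum>a<dA. ftr dB ((funit b' b * ((blk dB a)\<^sup>\<dagger> * X)) * blk dB a))"
        unfolding d_def
        by (intro sum.cong refl ftr_cyclic) (rule X[unfolded d_def] dims_blk b dims_intros | simp)+
      also have "\<dots> = c b b'"
        unfolding c_def
      proof (rule sum.cong[OF refl])
        fix a
        have "ftr dB ((funit b' b * ((blk dB a)\<^sup>\<dagger> * X)) * blk dB a)
            = (\<Sum>i<dB. if i = b' then ent ((blk dB a)\<^sup>\<dagger> * (X * blk dB a)) b i else 0)"
          unfolding ftr_def mult.assoc ent_funit_times by simp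
        also have "\<dots> = ent X (a * dB + b) (a * dB + b')"
          using b by (simp add: ent_blk_fadj_times ent_times_blk)
        finally show "ftr dB ((funit b' b * ((blk dB a)\<^sup>\<dagger> * X)) * blk dB a) = ent X (a * dB + b) (a * dB + b')" .
      qed
      finally show ?thesis .
    qed
    have "fm (R (E (mf n n (v * X * v\<^sup>\<dagger>)))) = (\<Sum>x\<in>I. L x * Z * (L x)\<^sup>\<dagger>)"
      unfolding R_def Ez fm_mf[OF dR] ..
    \<comment> \<open>The operators \<open>T\<close> vanish on \<open>Z\<close> by
      \<open>QZ\<close>.\<close>
    also have "\<dots> = (\<Sum>m<n. S m * Z * (S m)\<^sup>\<dagger>)"
      using L_sum[of "\<lambda>A. A * Z * A\<^sup>\<dagger>"] by (simp add: T_def mult.assoc[of _ "fid n - Q" Z] QZ)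
    also have "\<dots> = (\<Sum>m<n. \<Sum>b<dB. \<Sum>b'<dB. v * (funit b m * ((p (funit 0 b) * Z * (p (funit 0 b'))\<^sup>\<dagger>) * funit m b')) * v\<^sup>\<dagger>)"
      by (simp add: S_def sum_distrib_left sum_distrib_right mult.assoc)
        (rule sum.cong[OF refl], rule sum.swap)
    also have "\<dots> = (\<Sum>b<dB. \<Sum>b'<dB. \<Sum>m<n. v * (funit b m * ((p (funit 0 b) * Z * (p (funit 0 b'))\<^sup>\<dagger>) * funit m b')) * v\<^sup>\<dagger>)"
      by (rule trans[OF sum.swap sum.cong[OF refl sum.swap]])
    \<comment> \<open>Between matrix units the middle factor shrinks to its diagonal entry at
      \<open>m\<close>, and the sum over \<open>m\<close> is the trace from
      \<open>tr\<close>.\<close>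
    also have "\<dots> = (\<Sum>b<dB. \<Sum>b'<dB. c b b' *\<^sub>C (v * funit b b' * v\<^sup>\<dagger>))"
      unfolding funit_times_times_funit
      by (intro sum.cong refl) (simp add: fsmul_sum_left[symmetric] ftr_def[symmetric] tr)
    also have "\<dots> = v * (\<Sum>b<dB. \<Sum>b'<dB. c b b' *\<^sub>C funit b b') * v\<^sup>\<dagger>"
      by (simp add: sum_distrib_left sum_distrib_right)
    also have "(\<Sum>b<dB. \<Sum>b'<dB. c b b' *\<^sub>C funit b b') = fm (tensor_id dA dB F (mf d d X))"
    proof (rule fmat_dims_eqI)
      show "dims d d (fm (tensor_id dA dB F (mf d d X)))" unfolding d_def
        by (rule dims_fm) (simp add: tensor_id_def)
      show "dims d d (\<Sum>b<dB. \<Sum>b'<dB. c b b' *\<^sub>C funit b b')"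
        using dB_le by (intro dims_sum dims_fsmul dims_funit) auto
      fix t s assume ts: "t < d" "s < d"
      have tsA: "t div dB < dA" "s div dB < dA" using ts by (simp_all add: d_def less_mult_imp_div_less)
      define B where "B = mat dA dA (\<lambda>(a,a'). mf d d X $$ (a*dB + t mod dB, a'*dB + s mod dB))"
      have B: "ent (fm B) a a = ent X (a*dB + t mod dB) (a*dB + s mod dB)" if "a < dA" for a
        using that pos index_less[OF that, of "t mod dB" dB] index_less[OF that, of "s mod dB" dB]
        by (simp add: ent_fm B_def mf_def d_def)
      have "ent (fm (tensor_id dA dB F (mf d d X))) t s = F B $$ (t div dB, s div dB)"
        using ts by (simp add: ent_fm tensor_id_def d_def[symmetric] B_def)
      also have "\<dots> = (\<Sum>a<dA. ent (funit 0 a * fm B * funit a 0) (t div dB) (s div dB))"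
        using tsA by (simp add: F_def mf_def)
      \<comment> \<open>\<open>F\<close> has values in the corner (0,0) of A, so only the first
        block is nonzero; its indices are those below \<open>dB\<close>, where the
        \<open>funit b b'\<close> of the other side sit.\<close>
      also have "\<dots> = (if t div dB = 0 \<and> s div dB = 0 then c (t mod dB) (s mod dB) else 0)"
        unfolding c_def mult.assoc ent_funit_times ent_times_funit
        by (cases "t div dB = 0"; cases "s div dB = 0") (simp_all add: B)
      also have "\<dots> = (if t < dB \<and> s < dB then c t s else 0)"
        using pos by (auto simp: div_eq_0_iff)
      also have "\<dots> = (\<Sum>b<dB. if t = b then (\<Sum>b'<dB. if s = b' then c b b' else 0) else 0)"
        by auto
      also have "\<dots> = ent (\<Sum>b<dB. \<Sum>b'<dB. c b b' *\<^sub>C funit b b') t s"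
        unfolding ent_sum ent_fsmul ent_funit by (intro sum.cong refl) (auto simp: if_distrib[of "\<lambda>x. _ * x"] cong: if_cong)
      finally show "ent (\<Sum>b<dB. \<Sum>b'<dB. c b b' *\<^sub>C funit b b') t s = ent (fm (tensor_id dA dB F (mf d d X))) t s" ..
    qed
    finally show ?thesis .
  qed
  show ?thesis
    unfolding correctable_subsystem_def
  proof (intro exI conjI ballI)
    fix \<rho> :: "complex mat" assume \<rho>: "\<rho> \<in> carrier_mat n n"
    have "dims d d (v\<^sup>\<dagger> * fm \<rho> * v)" by (rule dv dims_fm[OF \<rho>] dims_intros)+
    then show "R (E (proj_C V * \<rho> * proj_C V)) = V * tensor_id dA dB F (adj V * \<rho> * V) * adj V"
      unfolding correctable_eq_iff[OF Rc E \<rho>] using main unfolding d_def by blast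
  qed (fact Rc Fc)+
qed

section \<open>From a recovery channel to the homomorphism\<close>

lemma star_hom_if_correctable:
  assumes E: "quantum_channel n E" and pos: "dA > 0"
    and corr: "correctable_subsystem n dA dB V E"
  shows "\<exists>\<pi>. star_hom (alg_B dA dB V) n \<pi> \<and> (\<forall>\<rho> \<in> alg_B dA dB V.
          E \<rho> = \<pi> \<rho> * E (proj_C V) \<and> E \<rho> = E (proj_C V) * \<pi> \<rho>)"
proof -
  define d where "d = dA * dB"
  note dv = dims_v[folded d_def] and vv = v_isometry[folded d_def]
  obtain R F where R: "quantum_channel n R" and F: "quantum_channel dA F"
    and RE: "\<And>\<rho>. \<rho> \<in> carrier_mat n n \<Longrightarrow>
      R (E (proj_C V * \<rho> * proj_C V)) = V * tensor_id dA dB F (adj V * \<rho> * V) * adj V"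
    using corr unfolding correctable_subsystem_def by blast
  obtain r :: nat and K where K: "kraus n {..<r} K"
    and EK: "\<And>A. A \<in> carrier_mat n n \<Longrightarrow> fm (E A) = (\<Sum>k<r. K k * fm A * (K k)\<^sup>\<dagger>)"
    using quantum_channel_kraus[OF E] by blast
  obtain q :: nat and L where L: "kraus n {..<q} L"
    and RL: "\<And>A. A \<in> carrier_mat n n \<Longrightarrow> fm (R A) = (\<Sum>k<q. L k * fm A * (L k)\<^sup>\<dagger>)"
    using quantum_channel_kraus[OF R] by blast
  have dK: "dims n n (K k)" if "k < r" for k using K that by (simp add: kraus_def)
  have dL: "dims n n (L k)" if "k < q" for k using L that by (simp add: kraus_def)
  have LL: "(\<Sum>k<q. (L k)\<^sup>\<dagger> * L k) = fid n" using L by (simp add: kraus_def)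
  have Ec: "E A \<in> carrier_mat n n" if "A \<in> carrier_mat n n" for A
    using E that by (simp add: quantum_channel_def lin_map_def)
  have dbl: "dims d dB (blk dB a)" if "a < dA" for a unfolding d_def by (rule dims_blk[OF that])
  define M where "M = (\<lambda>(k,a). K k * v * blk dB a)"
  define I where "I = {..<r} \<times> {..<dA}"
  have dM: "dims n dB (M i)" if "i \<in> I" for i
    using that dims_times[OF dims_times[OF dK dv] dbl] by (auto simp: I_def M_def)
  define P where "P = {..<q} \<times> {..<r}"
  \<comment> \<open>Kraus operators of the channel followed by the recovery, restricted to slice
    \<open>a\<close> of the code.\<close>
  define U where "U a = (\<lambda>(j,k). L j * M (k,a))" for a
  have dU: "dims n dB (U a x)" if "a < dA" "x \<in> P" for a x
    using that dims_times[OF dL dM] by (auto simp: P_def U_def I_def)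
  \<comment> \<open>(F \<otimes> id)(|a><a| \<otimes> Y), the outcome that correctability prescribes
    on slice \<open>a\<close>.\<close>
  define T where "T a Y = fm (tensor_id dA dB F (mf d d (blk dB a * Y * (blk dB a)\<^sup>\<dagger>)))" for a Y
  have dT: "dims d d (T a Y)" for a Y unfolding T_def d_def by (rule dims_fm) (simp add: tensor_id_def)
  have UT: "(\<Sum>x\<in>P. U a x * Y * (U a x)\<^sup>\<dagger>) = v * T a Y * v\<^sup>\<dagger>" if a: "a < dA" and Y: "dims dB dB Y" for a Y
  proof -
    define X where "X = blk dB a * Y * (blk dB a)\<^sup>\<dagger>"
    have dX: "dims d d X" unfolding X_def by (rule dbl[OF a] Y dims_intros)+
    have dvX: "dims n n (v * X * v\<^sup>\<dagger>)" by (rule dv dX dims_intros)+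
    have X: "v\<^sup>\<dagger> * (v * X * v\<^sup>\<dagger>) * v = X"
    proof -
      have "v\<^sup>\<dagger> * (v * X * v\<^sup>\<dagger>) * v = (v\<^sup>\<dagger> * v) * X * (v\<^sup>\<dagger> * v)" by (simp only: mult.assoc)
      then show ?thesis by (simp add: vv fid_times[OF dX] times_fid[OF dX])
    qed
    have "fm (R (E (mf n n (v * X * v\<^sup>\<dagger>)))) = v * T a Y * v\<^sup>\<dagger>"
      using RE[of "mf n n (v * X * v\<^sup>\<dagger>)"] correctable_eq_iff[OF R E, of "mf n n (v * X * v\<^sup>\<dagger>)" F]
      unfolding fm_mf[OF dvX] X d_def[symmetric] T_def X_def[symmetric] by simp
    moreover have "fm (R (E (mf n n (v * X * v\<^sup>\<dagger>)))) = (\<Sum>j<q. L j * (\<Sum>k<r. K k * (v * X * v\<^sup>\<dagger>) * (K k)\<^sup>\<dagger>) * (L j)\<^sup>\<dagger>)"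
      unfolding RL[OF Ec[OF mf_carrier]] EK[OF mf_carrier] fm_mf[OF dvX] ..
    moreover have "\<dots> = (\<Sum>x\<in>P. U a x * Y * (U a x)\<^sup>\<dagger>)"
      unfolding P_def
      by (simp add: sum.cartesian_product' U_def M_def X_def sum_distrib_left sum_distrib_right mult.assoc)
    ultimately show ?thesis by simp
  qed
  \<comment> \<open>The diagonal block at \<open>c\<close> of that outcome is \<open>Y\<close> times
    the entry (c,c) of F(|a><a|), a factor independent of \<open>Y\<close>.\<close>
  have TY: "\<exists>g. \<forall>Y. dims dB dB Y \<longrightarrow> (blk dB c)\<^sup>\<dagger> * T a Y * blk dB c = g *\<^sub>C Y" if a: "a < dA" and c: "c < dA" for a c
  proof (intro exI allI impI)
    define e where "e = mf dA dA (funit a a)"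
    fix Y assume Y: "dims dB dB Y"
    show "(blk dB c)\<^sup>\<dagger> * T a Y * blk dB c = (F e $$ (c,c)) *\<^sub>C Y"
    proof (rule fmat_dims_eqI)
      show "dims dB dB ((blk dB c)\<^sup>\<dagger> * T a Y * blk dB c)" by (rule dbl[OF c] dT dims_intros)+
      show "dims dB dB ((F e $$ (c,c)) *\<^sub>C Y)" by (rule dims_fsmul[OF Y])
      fix b b' assume b: "b < dB" "b' < dB"
      have cb: "c * dB + b < d" "c * dB + b' < d" using index_less[OF c] b by (auto simp: d_def)
      have "mat dA dA (\<lambda>(x,y). mf d d (blk dB a * Y * (blk dB a)\<^sup>\<dagger>) $$ (x * dB + b, y * dB + b')) = ent Y b b' \<cdot>\<^sub>m e"
      proof (rule eq_matI)
        fix x y assume "x < dim_row (ent Y b b' \<cdot>\<^sub>m e)" "y < dim_col (ent Y b b' \<cdot>\<^sub>m e)"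
        then have xy: "x < dA" "y < dA" by (auto simp: e_def mf_def)
        have "mf d d (blk dB a * Y * (blk dB a)\<^sup>\<dagger>) $$ (x * dB + b, y * dB + b')
            = ent (blk dB a * (Y * (blk dB a)\<^sup>\<dagger>)) (x * dB + b) (y * dB + b')"
          using index_less[OF xy(1) b(1)] index_less[OF xy(2) b(2)] by (simp add: mf_def d_def mult.assoc)
        also have "\<dots> = (if x = a \<and> y = a then ent Y b b' else 0)"
          using b by (auto simp: ent_blk_times ent_times_blk_fadj)
        finally show "mat dA dA (\<lambda>(x,y). mf d d (blk dB a * Y * (blk dB a)\<^sup>\<dagger>) $$ (x * dB + b, y * dB + b')) $$ (x,y)
            = (ent Y b b' \<cdot>\<^sub>m e) $$ (x,y)" using xy by (auto simp: e_def mf_def)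
      qed (auto simp: e_def mf_def)
      moreover have "F (ent Y b b' \<cdot>\<^sub>m e) = ent Y b b' \<cdot>\<^sub>m F e" "F e \<in> carrier_mat dA dA"
        using F by (simp_all add: quantum_channel_def lin_map_def e_def)
      ultimately have "ent (T a Y) (c * dB + b) (c * dB + b') = ent Y b b' * F e $$ (c,c)"
        using b c cb by (simp add: T_def ent_fm tensor_id_def d_def)
      then show "ent ((blk dB c)\<^sup>\<dagger> * T a Y * blk dB c) b b' = ent ((F e $$ (c,c)) *\<^sub>C Y) b b'"
        using b by (simp add: mult.assoc ent_blk_fadj_times ent_times_blk)
    qed
  qed
  have fP: "finite P" by (simp add: P_def)
  have vU: "v * (v\<^sup>\<dagger> * U a x) = U a x" if a: "a < dA" and x: "x \<in> P" for a x
  proof -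
    \<comment> \<open>The projection onto the complement of the code. By \<open>UT\<close> at the
      identity the recovered output has no part there, so every \<open>U a x\<close> maps into the
      code.\<close>
    define Z where "Z = fid n - v * v\<^sup>\<dagger>"
    have Zv: "Z * v = 0" by (simp add: Z_def left_diff_distrib mult.assoc vv fid_times[OF dv] times_fid[OF dv])
    have "(\<Sum>x\<in>P. (Z * U a x) * (Z * U a x)\<^sup>\<dagger>) = Z * (\<Sum>x\<in>P. U a x * fid dB * (U a x)\<^sup>\<dagger>) * Z\<^sup>\<dagger>"
      unfolding sum_distrib_left sum_distrib_right
      by (rule sum.cong) (auto simp: times_fid[OF dU[OF a]] mult.assoc)
    also have "\<dots> = (Z * v) * T a (fid dB) * v\<^sup>\<dagger> * Z\<^sup>\<dagger>"
      unfolding UT[OF a dims_fid] by (simp only: mult.assoc)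
    also have "\<dots> = 0" by (simp add: Zv)
    finally have "Z * U a x = 0" using sum_times_fadj_eq_0[OF fP _ x, of "\<lambda>x. Z * U a x"] by simp
    then show ?thesis by (simp add: Z_def left_diff_distrib mult.assoc fid_times[OF dU[OF a x]])
  qed
  \<comment> \<open>Compressing \<open>UT\<close> to slice \<open>c\<close> gives operators that
    together act on \<open>Y\<close> as the factor from \<open>TY\<close>, so the rigidity lemma
    makes each of them scalar.\<close>
  have "\<exists>t. (blk dB c)\<^sup>\<dagger> * (v\<^sup>\<dagger> * U a x) = t *\<^sub>C fid dB" if a: "a < dA" and c: "c < dA" and x: "x \<in> P" for a c x
  proof -
    obtain g where g: "\<And>Y. dims dB dB Y \<Longrightarrow> (blk dB c)\<^sup>\<dagger> * T a Y * blk dB c = g *\<^sub>C Y"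
      using TY[OF a c] by blast
    show ?thesis
    proof (rule sum_conj_scalar_imp_scalar[OF fP _ _ x])
      show "dims dB dB ((blk dB c)\<^sup>\<dagger> * (v\<^sup>\<dagger> * U a y))" if "y \<in> P" for y
        by (rule dbl[OF c] dv dU[OF a that] dims_intros)+
      fix Y assume Y: "dims dB dB Y"
      have "(\<Sum>x\<in>P. (blk dB c)\<^sup>\<dagger> * (v\<^sup>\<dagger> * U a x) * Y * ((blk dB c)\<^sup>\<dagger> * (v\<^sup>\<dagger> * U a x))\<^sup>\<dagger>)
          = (blk dB c)\<^sup>\<dagger> * (v\<^sup>\<dagger> * (\<Sum>x\<in>P. U a x * Y * (U a x)\<^sup>\<dagger>) * v) * blk dB c"
        by (simp add: sum_distrib_left sum_distrib_right mult.assoc)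
      also have "\<dots> = (blk dB c)\<^sup>\<dagger> * ((v\<^sup>\<dagger> * v) * T a Y * (v\<^sup>\<dagger> * v)) * blk dB c"
        unfolding UT[OF a Y] by (simp only: mult.assoc)
      also have "\<dots> = g *\<^sub>C Y" by (simp add: vv fid_times[OF dT] times_fid[OF dT] g[OF Y])
      finally show "(\<Sum>x\<in>P. (blk dB c)\<^sup>\<dagger> * (v\<^sup>\<dagger> * U a x) * Y * ((blk dB c)\<^sup>\<dagger> * (v\<^sup>\<dagger> * U a x))\<^sup>\<dagger>) = g *\<^sub>C Y" .
    qed
  qed
  then obtain t where t: "\<And>a c x. a < dA \<Longrightarrow> c < dA \<Longrightarrow> x \<in> P \<Longrightarrow> (blk dB c)\<^sup>\<dagger> * (v\<^sup>\<dagger> * U a x) = t a c x *\<^sub>C fid dB"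
    by metis
  have MM: "\<exists>c. (M i)\<^sup>\<dagger> * M i' = c *\<^sub>C fid dB" if i: "i \<in> I" and i': "i' \<in> I" for i i'
  proof -
    obtain k a k' a' where ka: "i = (k,a)" "i' = (k',a')" "k < r" "k' < r" "a < dA" "a' < dA"
      using i i' by (auto simp: I_def)
    \<comment> \<open>The sum of the \<open>(L j)\<^sup>\<dagger> * L j\<close> is the identity;
      inserting it replaces the \<open>M\<close> by the operators \<open>U\<close>, whose blocks are
      known to be scalar.\<close>
    have "(M i)\<^sup>\<dagger> * M i' = (M i)\<^sup>\<dagger> * ((\<Sum>j<q. (L j)\<^sup>\<dagger> * L j) * M i')"
      by (simp add: LL fid_times[OF dM[OF i']])
    also have "\<dots> = (\<Sum>j<q. (U a (j,k))\<^sup>\<dagger> * U a' (j,k'))"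
      by (simp add: sum_distrib_left sum_distrib_right U_def ka mult.assoc)
    also have "\<dots> = (\<Sum>j<q. (\<Sum>c<dA. cnj (t a c (j,k)) * t a' c (j,k')) *\<^sub>C fid dB)"
    proof (rule sum.cong[OF refl])
      fix j assume "j \<in> {..<q}"
      then have jk: "(j,k) \<in> P" "(j,k') \<in> P" using ka by (auto simp: P_def)
      have d2: "dims d dB (v\<^sup>\<dagger> * U a' (j,k'))" by (rule dv dU[OF ka(6) jk(2)] dims_intros)+
      have "(U a (j,k))\<^sup>\<dagger> * U a' (j,k') = (v * (v\<^sup>\<dagger> * U a (j,k)))\<^sup>\<dagger> * (v * (v\<^sup>\<dagger> * U a' (j,k')))"
        by (simp only: vU[OF ka(5) jk(1)] vU[OF ka(6) jk(2)])
      also have "\<dots> = (v\<^sup>\<dagger> * U a (j,k))\<^sup>\<dagger> * ((v\<^sup>\<dagger> * v) * (v\<^sup>\<dagger> * U a' (j,k')))"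
        by (simp only: fadj_times mult.assoc)
      \<comment> \<open>The identity on A \<otimes> B is split into slices, so that products of
        scalar blocks remain.\<close>
      also have "\<dots> = (v\<^sup>\<dagger> * U a (j,k))\<^sup>\<dagger> * ((\<Sum>c<dA. blk dB c * (blk dB c)\<^sup>\<dagger>) * (v\<^sup>\<dagger> * U a' (j,k')))"
        by (simp add: vv sum_blk_blk_fadj d_def)
      also have "\<dots> = (\<Sum>c<dA. ((blk dB c)\<^sup>\<dagger> * (v\<^sup>\<dagger> * U a (j,k)))\<^sup>\<dagger> * ((blk dB c)\<^sup>\<dagger> * (v\<^sup>\<dagger> * U a' (j,k'))))"
        by (simp add: sum_distrib_left sum_distrib_right mult.assoc)
      also have "\<dots> = (\<Sum>c<dA. (cnj (t a c (j,k)) * t a' c (j,k')) *\<^sub>C fid dB)"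
      proof (rule sum.cong[OF refl])
        fix c assume "c \<in> {..<dA}"
        then have c: "c < dA" by simp
        show "((blk dB c)\<^sup>\<dagger> * (v\<^sup>\<dagger> * U a (j,k)))\<^sup>\<dagger> * ((blk dB c)\<^sup>\<dagger> * (v\<^sup>\<dagger> * U a' (j,k')))
          = (cnj (t a c (j,k)) * t a' c (j,k')) *\<^sub>C fid dB"
          unfolding t[OF ka(5) c jk(1)] t[OF ka(6) c jk(2)] by (simp add: fid_times[of dB dB] mult.commute)
      qed
      finally show "(U a (j,k))\<^sup>\<dagger> * U a' (j,k') = (\<Sum>c<dA. cnj (t a c (j,k)) * t a' c (j,k')) *\<^sub>C fid dB"
        by (simp add: fsmul_sum_left)
    qed
    finally show ?thesis by (auto simp: fsmul_sum_left[symmetric])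
  qed
  have fI: "finite I" by (simp add: I_def)
  have "\<exists>W J. finite J \<and> (\<forall>i\<in>J. dims n dB (W i))
    \<and> (\<forall>i\<in>J. \<forall>j\<in>J. (W i)\<^sup>\<dagger> * W j = (if i = j then fid dB else 0))
    \<and> (\<forall>i\<in>I. \<exists>g. M i = (\<Sum>j\<in>J. g j *\<^sub>C W j)) \<and> J \<subseteq> I
    \<and> (\<forall>X. (\<forall>i\<in>I. \<exists>c. (M i)\<^sup>\<dagger> * X = c *\<^sub>C fid dB) \<longrightarrow> (\<forall>j\<in>J. \<exists>c. (W j)\<^sup>\<dagger> * X = c *\<^sub>C fid dB))"
    by (rule gram_schmidt_isometries[OF fI dM MM])
  then obtain W and J :: "(nat \<times> nat) set" where J: "finite J" and dW: "\<forall>i\<in>J. dims n dB (W i)"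
    and WW: "\<forall>i\<in>J. \<forall>j\<in>J. (W i)\<^sup>\<dagger> * W j = (if i = j then fid dB else 0)"
    and MW: "\<forall>i\<in>I. \<exists>g. M i = (\<Sum>j\<in>J. g j *\<^sub>C W j)"
    by (elim exE conjE) (rule that)
  \<comment> \<open>Copies of \<open>Y\<close> on the orthogonal ranges of the \<open>W i\<close>.
    Relation \<open>pW\<close> gives multiplicativity and, through \<open>MW\<close>, the
    intertwining with the \<open>M i\<close>.\<close>
  define p where "p Y = (\<Sum>i\<in>J. W i * Y * (W i)\<^sup>\<dagger>)" for Y
  have dp: "dims n n (p Y)" if "dims dB dB Y" for Y
    unfolding p_def by (rule dW[rule_format] that dims_intros | assumption)+
  have pW: "p Y * W j = W j * Y" if Y: "dims dB dB Y" and j: "j \<in> J" for Y j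
  proof -
    have "p Y * W j = (\<Sum>i\<in>J. if i = j then W j * (Y * fid dB) else 0)"
      unfolding p_def sum_distrib_right by (rule sum.cong) (auto simp: mult.assoc WW j)
    then show ?thesis using j J by (simp add: times_fid[OF Y])
  qed
  have pM: "p Y * M i = M i * Y" if Y: "dims dB dB Y" and i: "i \<in> I" for Y i
  proof -
    obtain g where g: "M i = (\<Sum>j\<in>J. g j *\<^sub>C W j)" using MW i by blast
    show ?thesis unfolding g sum_distrib_left sum_distrib_right by (rule sum.cong) (auto simp: pW[OF Y])
  qed
  have p_adj: "(p Y)\<^sup>\<dagger> = p (Y\<^sup>\<dagger>)" for Y by (simp add: p_def mult.assoc)
  have p_times: "p X * p Y = p (X * Y)" if X: "dims dB dB X" for X Y
  proof -
    have "p X * p Y = (\<Sum>j\<in>J. p X * W j * Y * (W j)\<^sup>\<dagger>)"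
      unfolding p_def[of Y] sum_distrib_left by (simp add: mult.assoc)
    also have "\<dots> = p (X * Y)"
      unfolding p_def[of "X * Y"] by (rule sum.cong) (auto simp: pW[OF X] mult.assoc)
    finally show ?thesis .
  qed
  have p_plus: "p X + p Y = p (X + Y)" for X Y by (simp add: p_def algebra_simps sum.distrib)
  have p_smul: "c *\<^sub>C p X = p (c *\<^sub>C X)" for c X by (simp add: p_def fsmul_sum_right)
  \<comment> \<open>Splitting I \<otimes> Y into slices shows that on the algebra the channel has
    the Kraus operators \<open>M i\<close>. Since \<open>p\<close> intertwines these, both
    factorisations follow.\<close>
  have EM: "fm (E (el Y)) = (\<Sum>i\<in>I. M i * Y * (M i)\<^sup>\<dagger>)" if Y: "dims dB dB Y" for Y
  proof -
    have "fm (E (el Y)) = (\<Sum>k<r. K k * (v * emb dA dB Y * v\<^sup>\<dagger>) * (K k)\<^sup>\<dagger>)"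
      unfolding EK[OF el_carrier] fm_el[OF Y] ..
    also have "\<dots> = (\<Sum>i\<in>I. M i * Y * (M i)\<^sup>\<dagger>)"
      unfolding I_def
      by (simp add: sum.cartesian_product' M_def emb_def sum_distrib_left sum_distrib_right mult.assoc)
    finally show ?thesis .
  qed
  define \<sigma> where "\<sigma> = fm (E (proj_C V))"
  have sig: "\<sigma> = (\<Sum>i\<in>I. M i * (M i)\<^sup>\<dagger>)"
    unfolding \<sigma>_def proj_C_eq EM[OF dims_fid] by (rule sum.cong) (auto simp: times_fid[OF dM])
  have E1: "fm (E (el Y)) = p Y * \<sigma>" if Y: "dims dB dB Y" for Y
    unfolding EM[OF Y] sig sum_distrib_left mult.assoc[symmetric] by (rule sum.cong) (auto simp: pM[OF Y])
  have E2: "fm (E (el Y)) = \<sigma> * p Y" if Y: "dims dB dB Y" for Y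
  proof -
    \<comment> \<open>The adjoint of \<open>pM\<close>, taken at the adjoint of
      \<open>Y\<close>.\<close>
    have MY: "(M i)\<^sup>\<dagger> * p Y = Y * (M i)\<^sup>\<dagger>" if "i \<in> I" for i
      using arg_cong[OF pM[OF dims_fadj[OF Y] that], of fadj] by (simp add: p_adj)
    show ?thesis
      unfolding EM[OF Y] sig sum_distrib_right mult.assoc by (rule sum.cong) (auto simp: MY)
  qed
  \<comment> \<open>The argument is an element of the algebra rather than \<open>Y\<close> itself.
    Compression to the code and then to slice 0, which exists because \<open>dA > 0\<close>,
    extracts \<open>Y\<close> from I \<otimes> Y.\<close>
  define \<pi> where "\<pi> x = mf n n (p ((blk dB 0)\<^sup>\<dagger> * (v\<^sup>\<dagger> * fm x * v) * blk dB 0))" for x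
  have pel: "\<pi> (el Y) = mf n n (p Y)" if Y: "dims dB dB Y" for Y
  proof -
    have dE: "dims d d (emb dA dB Y)" unfolding d_def by (rule dims_emb[OF Y])
    have "v\<^sup>\<dagger> * fm (el Y) * v = (v\<^sup>\<dagger> * v) * emb dA dB Y * (v\<^sup>\<dagger> * v)"
      unfolding fm_el[OF Y] by (simp only: mult.assoc)
    also have "\<dots> = emb dA dB Y" by (simp add: vv fid_times[OF dE] times_fid[OF dE])
    finally have "(blk dB 0)\<^sup>\<dagger> * (v\<^sup>\<dagger> * fm (el Y) * v) * blk dB 0 = (blk dB 0)\<^sup>\<dagger> * (blk dB 0 * Y)"
      by (simp add: mult.assoc emb_times_blk[OF Y pos])
    also have "\<dots> = Y" by (simp add: mult.assoc[symmetric] blk_fadj_times_blk fid_times[OF Y])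
    finally show ?thesis by (simp add: \<pi>_def)
  qed
  have fpi: "fm (\<pi> (el Y)) = p Y" if "dims dB dB Y" for Y
    unfolding pel[OF that] by (rule fm_mf[OF dp[OF that]])
  have pc: "\<pi> x \<in> carrier_mat n n" for x by (simp add: \<pi>_def)
  have "star_hom (alg_B dA dB V) n \<pi>"
    unfolding star_hom_def alg_B_eq
  proof (intro conjI ballI allI, goal_cases)
    case (2 x y)
    then obtain X Y where *: "dims dB dB X" "dims dB dB Y" "x = el X" "y = el Y" by blast
    show ?case unfolding *(3,4)
      by (rule fm_inject[OF pc]) (simp_all add: * pc el_plus dims_plus fpi p_plus fm_plus[OF pc pc])
  next
    case (3 x c)
    then obtain X where *: "dims dB dB X" "x = el X" by blast
    show ?case unfolding *(2)
      by (rule fm_inject[OF pc]) (simp_all add: * pc el_smult dims_fsmul fpi p_smul fm_smult)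
  next
    case (4 x y)
    then obtain X Y where *: "dims dB dB X" "dims dB dB Y" "x = el X" "y = el Y" by blast
    show ?case unfolding *(3,4)
      by (rule fm_inject[OF pc])
        (simp_all add: * pc mult_carrier_mat[OF pc pc] el_times dims_times[of dB dB] fpi p_times fm_times[OF pc pc])
  next
    case (5 x)
    then obtain X where *: "dims dB dB X" "x = el X" by blast
    show ?case unfolding *(2)
      by (rule fm_inject[OF pc]) (simp_all add: * adj_carrier[OF pc] el_adj dims_fadj fpi p_adj fm_adj)
  qed (rule pc)
  moreover have "E \<rho> = \<pi> \<rho> * E (proj_C V) \<and> E \<rho> = E (proj_C V) * \<pi> \<rho>" if in_B: "\<rho> \<in> alg_B dA dB V" for \<rho>
  proof -
    obtain Y where Y: "dims dB dB Y" and \<rho>: "\<rho> = el Y" using in_B by (auto simp: alg_B_eq)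
    have Pc: "E (proj_C V) \<in> carrier_mat n n" by (intro Ec) (simp add: proj_C_eq)
    have Ey: "E (el Y) \<in> carrier_mat n n" by (rule Ec) simp
    have "E (el Y) = \<pi> (el Y) * E (proj_C V)"
      by (rule fm_inject[OF Ey mult_carrier_mat[OF pc Pc]])
        (simp add: fm_times[OF pc Pc] fpi[OF Y] E1[OF Y] \<sigma>_def)
    moreover have "E (el Y) = E (proj_C V) * \<pi> (el Y)"
      by (rule fm_inject[OF Ey mult_carrier_mat[OF Pc pc]])
        (simp add: fm_times[OF Pc pc] fpi[OF Y] E2[OF Y] \<sigma>_def)
    ultimately show ?thesis by (simp add: \<rho>)
  qed
  ultimately show ?thesis by blast
qed

text \<open>A factor of dimension zero forces \<open>v = 0\<close>, so both sides of every equation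
  vanish; any channels serve as \<open>R\<close> and \<open>F\<close>, and \<pi> = 0. The case is
  split off because the general constructions use the basis vector 0 of A and, for the recovery, of
  B.\<close>

lemma equivalence_degenerate:
  assumes E: "quantum_channel n E" and 0: "dA * dB = 0"
  shows "correctable_subsystem n dA dB V E"
    and "\<exists>\<pi>. star_hom (alg_B dA dB V) n \<pi> \<and> (\<forall>\<rho> \<in> alg_B dA dB V.
          E \<rho> = \<pi> \<rho> * E (proj_C V) \<and> E \<rho> = E (proj_C V) * \<pi> \<rho>)"
proof -
  have v0: "v = 0" using dims_v[unfolded 0] by (intro fmat_eqI) (simp add: dims_def)
  have id: "\<exists>R. quantum_channel k R" for k
  proof -
    have "kraus k {()} (\<lambda>_. fid k)" by (simp add: kraus_def fid_times[of k k])
    then show ?thesis using kraus_quantum_channel by blast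
  qed
  obtain R where R: "quantum_channel n R" using id by blast
  obtain F where F: "quantum_channel dA F" using id by blast
  have z: "E (mf n n 0) = 0\<^sub>m n n" "R (0\<^sub>m n n) = 0\<^sub>m n n"
    using quantum_channel_zero[OF E, of "mf n n 0"] quantum_channel_zero[OF R, of "0\<^sub>m n n"] by (simp_all add: fm_mf fm_zero)
  show "correctable_subsystem n dA dB V E"
    unfolding correctable_subsystem_def
  proof (intro exI conjI ballI)
    fix \<rho> :: "complex mat" assume \<rho>: "\<rho> \<in> carrier_mat n n"
    show "R (E (proj_C V * \<rho> * proj_C V)) = V * tensor_id dA dB F (adj V * \<rho> * V) * adj V"
      unfolding correctable_eq_iff[OF R E \<rho>] by (simp add: v0 z fm_zero)
  qed (fact R F)+
  have el0: "el Y = 0\<^sub>m n n" for Y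
    by (rule fm_inject[of _ n n]) (simp_all add: el_def v0 fm_mf fm_zero)
  have E0: "E (0\<^sub>m n n) = 0\<^sub>m n n" by (rule quantum_channel_zero[OF E]) (simp_all add: fm_zero)
  have adj0: "adj (0\<^sub>m n n) = 0\<^sub>m n n" by (rule eq_matI) (auto simp: adj_def)
  show "\<exists>\<pi>. star_hom (alg_B dA dB V) n \<pi> \<and> (\<forall>\<rho> \<in> alg_B dA dB V.
          E \<rho> = \<pi> \<rho> * E (proj_C V) \<and> E \<rho> = E (proj_C V) * \<pi> \<rho>)"
    by (intro exI[of _ "\<lambda>_. 0\<^sub>m n n"]) (auto simp: star_hom_def alg_B_eq proj_C_eq el0 E0 adj0)
qed

end

theorem theorem5:
  fixes n dA dB :: nat and V :: "complex mat" and E :: "complex mat \<Rightarrow> complex mat"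
  assumes "quantum_channel n E"
    and "isometry n (dA * dB) V"
  shows "correctable_subsystem n dA dB V E \<longleftrightarrow>
    (\<exists>\<pi>. star_hom (alg_B dA dB V) n \<pi> \<and>
       (\<forall>\<rho> \<in> alg_B dA dB V.
          E \<rho> = \<pi> \<rho> * E (proj_C V) \<and> E \<rho> = E (proj_C V) * \<pi> \<rho>))"
proof -
  interpret subsystem n dA dB V by unfold_locales (rule assms(2))
  show ?thesis
  proof (cases "dA * dB = 0")
    case True
    then show ?thesis using equivalence_degenerate[OF assms(1)] by blast
  next
    case False
    then have "dA > 0" "dB > 0" by auto
    then show ?thesis
      using star_hom_if_correctable[OF assms(1)] correctable_if_star_hom[OF assms(1)] by blast
  qed
qed

end
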